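(* Let $\mathbf{r}$ be a table with $n$ tuples and let $A, B$ be two attributes such that the functional dependency $A \to B$ holds in $\mathbf{r}$. Suppose one of the two attributes carries a known explicit order and the other one, call it the implicit attribute, does not. Let $m$ be the number of distinct values of $B$ in $\mathbf{r}$. Then E/I OD discovery with empty context (deciding whether the explicit-to-implicit order compatibility between the two attributes is valid over $\mathbf{r}$ and, if so, computing the strongest derivable order on the implicit attribute) can be done in time $\mathcal{O}(m \ln m + n)$.
   Context: A table $\mathbf{r}$ is a finite collection of tuples; $t_C$ is the value of tuple $t$ on attribute $C$. The functional dependency (FD) $A\to B$ holds in $\mathbf r$ if any two tuples of $\mathbf r$ that agree on $A$ agree on $B$. A strong total order is a transitive, irreflexive relation in which any two distinct elements are comparable. An explicit order on an attribute is a given strong total order on its values. For a strong total order $T$ on the tuples and an attribute $C$, list the $C$-values of the tuples in the order $T$ and collapse adjacent equal values. If no value then occurs twice, $T$ is said to project to a strong total order on $C$'s values, called the order derived from $T$ on $C$. Let $E$ be the attribute with explicit order $<$ and $I$ the implicit attribute ($\{E,I\}=\{A,B\}$). The explicit-to-implicit order compatibility (E/I OC) $E \sim I^*$ with empty context is valid over $\mathbf{r}$ if there is a strong total order $T$ on the tuples (a witness) such that $s_E < t_E$ implies $s$ precedes $t$ in $T$, and $T$ projects to a strong total order on $I$'s values. When it is valid, the strongest derivable order $I^*$ is the intersection, over all witnesses, of the orders derived on $I$; it is output as a sorted list of groups of $I$-values when it is a weak order. An E/I OD is an E/I OC for which an FD holds between the two attributes. Hashing and comparing values cost constant time (hash tables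 are used). *)

theory Defs
  imports Complex_Main
begin

section \<open>Tables and explicit-to-implicit order compatibility\<close>

text \<open>
  A table is the list of its tuples, in an arbitrary order; a tuple maps attributes to values.
  A tuple is identified by its position in the list, so that a table may contain several tuples
  with equal values, and orders on the tuples are orders on the positions.
\<close>

type_synonym ('c, 'v) table = "('c \<Rightarrow> 'v) list"

definition column_values :: "('c, 'v) table \<Rightarrow> 'c \<Rightarrow> 'v set" where
  "column_values r C = (\<lambda>t. t C) ` set r"

definition fd_holds :: "('c, 'v) table \<Rightarrow> 'c \<Rightarrow> 'c \<Rightarrow> bool" where
  "fd_holds r A B \<longleftrightarrow> (\<forall>s\<in>set r. \<forall>t\<in>set r. s A = t A \<longrightarrow> s B = t B)"

definition listing :: "'a set \<Rightarrow> 'a rel \<Rightarrow> 'a list" where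
  "listing A T = (THE xs. distinct xs \<and> set xs = A \<and> sorted_wrt (\<lambda>x y. (x, y) \<in> T) xs)"

lemma ex1_listing:
  assumes "finite A" "strict_linear_order_on A T"
  shows "\<exists>!xs. distinct xs \<and> set xs = A \<and> sorted_wrt (\<lambda>x y. (x, y) \<in> T) xs"
proof -
  have tr: "trans T" and ir: "irrefl T"
    using assms(2) by (auto simp: strict_linear_order_on_def)
  have "\<exists>xs. distinct xs \<and> set xs = A \<and> sorted_wrt (\<lambda>x y. (x, y) \<in> T) xs"
    using assms
  proof (induction A rule: finite_induct)
    case empty
    then show ?case by simp
  next
    case (insert a F)
    then have "strict_linear_order_on F T"
      by (auto simp: strict_linear_order_on_def total_on_def)
    then obtain xs where xs: "distinct xs" "set xs = F" "sorted_wrt (\<lambda>x y. (x, y) \<in> T) xs"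
      using insert.IH by blast
    let ?ys = "filter (\<lambda>y. (y, a) \<in> T) xs @ [a] @ filter (\<lambda>y. (a, y) \<in> T) xs"
    have tot: "(y, a) \<in> T \<or> (a, y) \<in> T" if "y \<in> F" for y
      using insert.prems insert.hyps that unfolding strict_linear_order_on_def total_on_def by (metis insertCI)
    have asym: "\<not> ((y, a) \<in> T \<and> (a, y) \<in> T)" for y
      using tr ir by (meson irrefl_def transD)
    have "distinct ?ys" using xs insert.hyps asym by auto
    moreover have "set ?ys = insert a F" using xs tot by auto
    moreover have "sorted_wrt (\<lambda>x y. (x, y) \<in> T) ?ys"
      using xs tr by (auto simp: sorted_wrt_append sorted_wrt_filter dest: transD)
    ultimately show ?case by blast
  qed
  moreover have "xs = ys"
    if "distinct xs \<and> set xs = A \<and> sorted_wrt (\<lambda>x y. (x, y) \<in> T) xs"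
      "distinct ys \<and> set ys = A \<and> sorted_wrt (\<lambda>x y. (x, y) \<in> T) ys" for xs ys A
    using that
  proof (induction xs arbitrary: ys A)
    case Nil
    then show ?case by auto
  next
    case (Cons x xs)
    then obtain y ys' where ys: "ys = y # ys'" by (cases ys) auto
    have "x = y"
    proof (rule ccontr)
      assume ne: "x \<noteq> y"
      from Cons.prems(1) have s1: "set (x # xs) = A" by blast
      from Cons.prems(2) have s2: "set (y # ys') = A" unfolding ys by blast
      have "y \<in> set (x # xs)" unfolding s1 using s2 by auto
      then have "y \<in> set xs" using ne by simp
      moreover have "x \<in> set (y # ys')" unfolding s2 using s1 by auto
      then have "x \<in> set ys'" using ne by simp
      ultimately have "(x, y) \<in> T" "(y, x) \<in> T" using Cons.prems ys by auto
      then show False using tr ir by (meson irrefl_def transD)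
    qed
    moreover have "xs = ys'"
      using Cons.prems ys \<open>x = y\<close> by (intro Cons.IH[of "set xs"]) auto
    ultimately show ?case using ys by simp
  qed
  ultimately show ?thesis by blast
qed

definition collapsed_column :: "('c, 'v) table \<Rightarrow> 'c \<Rightarrow> nat rel \<Rightarrow> 'v list" where
  "collapsed_column r C T = remdups_adj (map (\<lambda>i. (r ! i) C) (listing {..<length r} T))"

definition projects :: "('c, 'v) table \<Rightarrow> 'c \<Rightarrow> nat rel \<Rightarrow> bool" where
  "projects r C T \<longleftrightarrow> distinct (collapsed_column r C T)"

definition list_order :: "'a list \<Rightarrow> 'a rel" where
  "list_order xs = {(xs ! i, xs ! j) | i j. i < j \<and> j < length xs}"

definition derived_order :: "('c, 'v) table \<Rightarrow> 'c \<Rightarrow> nat rel \<Rightarrow> 'v rel" where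
  "derived_order r C T = list_order (collapsed_column r C T)"

text \<open>\<open>lt\<close> is the explicit order on the values of the explicit attribute \<open>E\<close>.\<close>

definition witness :: "('c, 'v) table \<Rightarrow> 'c \<Rightarrow> 'v rel \<Rightarrow> 'c \<Rightarrow> nat rel \<Rightarrow> bool" where
  "witness r E lt I T \<longleftrightarrow>
     strict_linear_order_on {..<length r} T \<and>
     (\<forall>i<length r. \<forall>j<length r. ((r ! i) E, (r ! j) E) \<in> lt \<longrightarrow> (i, j) \<in> T) \<and>
     projects r I T"

definition ei_oc_valid :: "('c, 'v) table \<Rightarrow> 'c \<Rightarrow> 'v rel \<Rightarrow> 'c \<Rightarrow> bool" where
  "ei_oc_valid r E lt I \<longleftrightarrow> (\<exists>T. witness r E lt I T)"

definition strongest_derivable_order ::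
    "('c, 'v) table \<Rightarrow> 'c \<Rightarrow> 'v rel \<Rightarrow> 'c \<Rightarrow> 'v rel" where
  "strongest_derivable_order r E lt I = (\<Inter>T\<in>{T. witness r E lt I T}. derived_order r I T)"

text \<open>A weak order \<open>R\<close> on the set \<open>V\<close>, presented as the sorted list of its groups.\<close>

definition sorted_groups :: "'v set \<Rightarrow> 'v rel \<Rightarrow> 'v list list \<Rightarrow> bool" where
  "sorted_groups V R gs \<longleftrightarrow>
     distinct (concat gs) \<and> [] \<notin> set gs \<and> set (concat gs) = V \<and>
     R = {(x, y). \<exists>i j. i < j \<and> j < length gs \<and> x \<in> set (gs ! i) \<and> y \<in> set (gs ! j)}"

definition ei_discovery_result ::
    "('c, 'v) table \<Rightarrow> 'c \<Rightarrow> 'v rel \<Rightarrow> 'c \<Rightarrow> 'v list list option \<Rightarrow> bool" where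
  "ei_discovery_result r E lt I res \<longleftrightarrow>
     (case res of
        None \<Rightarrow> \<not> ei_oc_valid r E lt I
      | Some gs \<Rightarrow> ei_oc_valid r E lt I \<and>
          sorted_groups (column_values r I) (strongest_derivable_order r E lt I) gs)"


section \<open>The machine model\<close>

text \<open>
  Algorithms are WHILE programs over binary trees (as in N. D. Jones, Computability and
  Complexity), whose leaves are \<open>NIL\<close> or table values, extended by hash tables.
  All primitives are implementable in constant time on a pointer machine with
  constant-time hashing and comparison of values: trees are immutable pointer structures, so
  copying and \<open>CONS\<close> take constant time; \<open>ESame\<close> and \<open>ELess\<close> only compare two values; hash tables
  are keyed by values only. Values are otherwise opaque: programs contain no value constants, and
  there is no arithmetic, so nothing can be gained by packing data into large numbers.
\<close>

datatype 'v tree = NIL | VAL 'v | CONS "'v tree" "'v tree"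

datatype expr =
    EVar nat
  | ENil
  | ECons expr expr
  | EHd expr
  | ETl expr
  | ESame expr expr
  | ELess expr expr
  | EGet nat expr

datatype cmd =
    Skip
  | Assign nat expr
  | Put nat expr expr
  | Seq cmd cmd
  | If expr cmd cmd
  | While expr cmd

text \<open>A state holds the contents of the variables and of the (numbered) hash tables; a key that is
  absent from a hash table is mapped to \<open>NIL\<close>.\<close>

type_synonym 'v state = "(nat \<Rightarrow> 'v tree) \<times> (nat \<Rightarrow> 'v \<Rightarrow> 'v tree)"

fun hd_tree :: "'v tree \<Rightarrow> 'v tree" where
  "hd_tree (CONS a b) = a"
| "hd_tree _ = NIL"

fun tl_tree :: "'v tree \<Rightarrow> 'v tree" where
  "tl_tree (CONS a b) = b"
| "tl_tree _ = NIL"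

fun same_val :: "'v tree \<Rightarrow> 'v tree \<Rightarrow> bool" where
  "same_val (VAL v) (VAL w) = (v = w)"
| "same_val _ _ = False"

fun less_val :: "'v rel \<Rightarrow> 'v tree \<Rightarrow> 'v tree \<Rightarrow> bool" where
  "less_val lt (VAL v) (VAL w) = ((v, w) \<in> lt)"
| "less_val lt _ _ = False"

fun get_val :: "('v \<Rightarrow> 'v tree) \<Rightarrow> 'v tree \<Rightarrow> 'v tree" where
  "get_val h (VAL v) = h v"
| "get_val h _ = NIL"

fun put_val :: "('v \<Rightarrow> 'v tree) \<Rightarrow> 'v tree \<Rightarrow> 'v tree \<Rightarrow> ('v \<Rightarrow> 'v tree)" where
  "put_val h (VAL v) d = h(v := d)"
| "put_val h _ d = h"

definition bool_tree :: "bool \<Rightarrow> 'v tree" where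
  "bool_tree b = (if b then CONS NIL NIL else NIL)"

primrec eval_expr :: "'v rel \<Rightarrow> 'v state \<Rightarrow> expr \<Rightarrow> 'v tree" where
  "eval_expr lt s (EVar x) = fst s x"
| "eval_expr lt s ENil = NIL"
| "eval_expr lt s (ECons a b) = CONS (eval_expr lt s a) (eval_expr lt s b)"
| "eval_expr lt s (EHd a) = hd_tree (eval_expr lt s a)"
| "eval_expr lt s (ETl a) = tl_tree (eval_expr lt s a)"
| "eval_expr lt s (ESame a b) = bool_tree (same_val (eval_expr lt s a) (eval_expr lt s b))"
| "eval_expr lt s (ELess a b) = bool_tree (less_val lt (eval_expr lt s a) (eval_expr lt s b))"
| "eval_expr lt s (EGet h a) = get_val (snd s h) (eval_expr lt s a)"

primrec expr_cost :: "expr \<Rightarrow> nat" where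
  "expr_cost (EVar x) = 1"
| "expr_cost ENil = 1"
| "expr_cost (ECons a b) = 1 + expr_cost a + expr_cost b"
| "expr_cost (EHd a) = 1 + expr_cost a"
| "expr_cost (ETl a) = 1 + expr_cost a"
| "expr_cost (ESame a b) = 1 + expr_cost a + expr_cost b"
| "expr_cost (ELess a b) = 1 + expr_cost a + expr_cost b"
| "expr_cost (EGet h a) = 1 + expr_cost a"

text \<open>\<open>exec lt c s k s'\<close>: started in \<open>s\<close>, the program \<open>c\<close> terminates in \<open>s'\<close> after \<open>k\<close> steps.
  Every tree other than \<open>NIL\<close> counts as true.\<close>

inductive exec :: "'v rel \<Rightarrow> cmd \<Rightarrow> 'v state \<Rightarrow> nat \<Rightarrow> 'v state \<Rightarrow> bool" for lt where
  Skip: "exec lt Skip s 1 s"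
| Assign: "exec lt (Assign x e) s (1 + expr_cost e) ((fst s)(x := eval_expr lt s e), snd s)"
| Put: "exec lt (Put h e1 e2) s (1 + expr_cost e1 + expr_cost e2)
          (fst s, (snd s)(h := put_val (snd s h) (eval_expr lt s e1) (eval_expr lt s e2)))"
| Seq: "exec lt c1 s k1 s' \<Longrightarrow> exec lt c2 s' k2 s'' \<Longrightarrow> exec lt (Seq c1 c2) s (k1 + k2) s''"
| IfTrue: "eval_expr lt s e \<noteq> NIL \<Longrightarrow> exec lt c1 s k s' \<Longrightarrow>
    exec lt (If e c1 c2) s (1 + expr_cost e + k) s'"
| IfFalse: "eval_expr lt s e = NIL \<Longrightarrow> exec lt c2 s k s' \<Longrightarrow>
    exec lt (If e c1 c2) s (1 + expr_cost e + k) s'"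
| WhileFalse: "eval_expr lt s e = NIL \<Longrightarrow> exec lt (While e c) s (1 + expr_cost e) s"
| WhileTrue: "eval_expr lt s e \<noteq> NIL \<Longrightarrow> exec lt c s k1 s' \<Longrightarrow> exec lt (While e c) s' k2 s'' \<Longrightarrow>
    exec lt (While e c) s (1 + expr_cost e + k1 + k2) s''"

lemma exec_deterministic:
  assumes "exec lt c s k s'" "exec lt c s l s''"
  shows "k = l \<and> s' = s''"
  using assms
proof (induction arbitrary: l s'' rule: exec.induct)
  case (Seq c1 s k1 s' c2 k2 s'')
  from Seq.prems show ?case by (cases) (use Seq.IH in blast)
next
  case (WhileTrue s e c k1 s' k2 s'')
  from WhileTrue.prems show ?case by (cases) (use WhileTrue.hyps WhileTrue.IH in blast)+
next
  case (IfTrue s e c1 k s' c2)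
  from IfTrue.prems show ?case by (cases) (use IfTrue.hyps IfTrue.IH in blast)+
next
  case (IfFalse s e c2 k s' c1)
  from IfFalse.prems show ?case by (cases) (use IfFalse.hyps IfFalse.IH in blast)+
qed (auto elim: exec.cases)

text \<open>Input and output are passed in variable 0; everything else is initially empty.\<close>

definition computes_in :: "cmd \<Rightarrow> 'v rel \<Rightarrow> 'v tree \<Rightarrow> nat \<Rightarrow> 'v tree \<Rightarrow> bool" where
  "computes_in P lt inp k out \<longleftrightarrow>
     (\<exists>s. exec lt P ((\<lambda>_. NIL)(0 := inp), \<lambda>_ _. NIL) k s \<and> fst s 0 = out)"

primrec list_tree :: "'v tree list \<Rightarrow> 'v tree" where
  "list_tree [] = NIL"
| "list_tree (d # ds) = CONS d (list_tree ds)"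

text \<open>The input tells which of the two attributes is the explicit one, and lists the tuples.\<close>

definition input_tree :: "('c, 'v) table \<Rightarrow> 'c \<Rightarrow> 'c \<Rightarrow> 'c \<Rightarrow> 'v tree" where
  "input_tree r A B E =
     CONS (bool_tree (E = A)) (list_tree (map (\<lambda>t. CONS (VAL (t A)) (VAL (t B))) r))"

fun output_tree :: "'v list list option \<Rightarrow> 'v tree" where
  "output_tree None = NIL"
| "output_tree (Some gs) = CONS NIL (list_tree (map (\<lambda>g. list_tree (map VAL g)) gs))"

end

theory Submission
  imports Defs "HOL-Library.Multiset"
begin

text \<open>
  The cases \<open>E = A\<close> and \<open>E = B\<close> are solved by the same program. Call the \<open>I\<close>-values
  occurring with a \<open>B\<close>-value \<open>b\<close> the group of \<open>b\<close>, and let \<open>mn b\<close>, \<open>mx b\<close> be the least and the greatest \<open>E\<close>-value occurring with \<open>b\<close>. A scan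
  of the table computes the groups, \<open>mn\<close> and \<open>mx\<close> in hash tables; then the \<open>m\<close> values of \<open>B\<close> are merge
  sorted by \<open>mn\<close>, and the compatibility is valid iff \<open>mx b < mn b'\<close> for all neighbours \<open>b\<close>, \<open>b'\<close> in the
  sorted list. In that case any two groups are ordered the same way by all witnesses. If \<open>I = B\<close>, the
  groups are singletons; if \<open>E = B\<close>, all tuples of a group agree on \<open>E\<close>, so that every permutation
  of the group is realised by a witness. Either way the strongest derivable order is the
  sorted list of the groups.
\<close>

subsection \<open>Symbolic execution with costs\<close>

text \<open>Total correctness with the number of steps as an extra argument of the postcondition.
  Since \<open>exec\<close> is deterministic, the run whose existence is asserted is the only
  one.\<close>

definition wp :: "'v rel \<Rightarrow> cmd \<Rightarrow> 'v state \<Rightarrow> (nat \<Rightarrow> 'v state \<Rightarrow> bool) \<Rightarrow> bool" where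
  "wp lt c s Q \<longleftrightarrow> (\<exists>k s'. exec lt c s k s' \<and> Q k s')"

inductive_simps exec_Skip_iff: "exec lt Skip s k s'"
inductive_simps exec_Assign_iff: "exec lt (Assign x e) s k s'"
inductive_simps exec_Put_iff: "exec lt (Put t e1 e2) s k s'"
inductive_simps exec_Seq_iff: "exec lt (Seq c1 c2) s k s'"
inductive_simps exec_If_iff: "exec lt (If e c1 c2) s k s'"
inductive_simps exec_While_iff: "exec lt (While e c) s k s'"

lemma wp_Skip [simp]: "wp lt Skip s Q = Q 1 s"
  unfolding wp_def exec_Skip_iff by simp

lemma wp_Assign [simp]:
  "wp lt (Assign x e) (v, h) Q = Q (1 + expr_cost e) (v(x := eval_expr lt (v, h) e), h)"
  unfolding wp_def exec_Assign_iff by (simp del: split_paired_Ex)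

lemma wp_Put [simp]:
  "wp lt (Put t e1 e2) (v, h) Q = Q (1 + expr_cost e1 + expr_cost e2)
     (v, h(t := put_val (h t) (eval_expr lt (v, h) e1) (eval_expr lt (v, h) e2)))"
  unfolding wp_def exec_Put_iff by (simp del: split_paired_Ex)

lemma wp_Seq [simp]:
  "wp lt (Seq c1 c2) s Q = wp lt c1 s (\<lambda>k s'. wp lt c2 s' (\<lambda>l s''. Q (k + l) s''))"
proof
  assume "wp lt (Seq c1 c2) s Q"
  then obtain k1 s' k2 s'' where "exec lt c1 s k1 s'" "exec lt c2 s' k2 s''" "Q (k1 + k2) s''"
    unfolding wp_def exec_Seq_iff by clarsimp
  then show "wp lt c1 s (\<lambda>k s'. wp lt c2 s' (\<lambda>l s''. Q (k + l) s''))"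
    unfolding wp_def by blast
next
  assume "wp lt c1 s (\<lambda>k s'. wp lt c2 s' (\<lambda>l s''. Q (k + l) s''))"
  then obtain k1 s' k2 s'' where "exec lt c1 s k1 s'" "exec lt c2 s' k2 s''" "Q (k1 + k2) s''"
    unfolding wp_def by clarsimp
  then show "wp lt (Seq c1 c2) s Q"
    unfolding wp_def using exec.Seq by blast
qed

lemma wp_If [simp]:
  "wp lt (If e c1 c2) s Q =
     (if eval_expr lt s e \<noteq> NIL then wp lt c1 s (\<lambda>k s'. Q (1 + expr_cost e + k) s')
      else wp lt c2 s (\<lambda>k s'. Q (1 + expr_cost e + k) s'))"
proof (cases "eval_expr lt s e = NIL")
  case True
  then have "exec lt (If e c1 c2) s k s' \<longleftrightarrow>
      (\<exists>l. k = 1 + expr_cost e + l \<and> exec lt c2 s l s')" for k s'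
    by (simp add: exec_If_iff)
  with True show ?thesis
    unfolding wp_def by auto
next
  case False
  then have "exec lt (If e c1 c2) s k s' \<longleftrightarrow>
      (\<exists>l. k = 1 + expr_cost e + l \<and> exec lt c1 s l s')" for k s'
    by (simp add: exec_If_iff)
  with False show ?thesis
    unfolding wp_def by auto
qed

text \<open>Kept out of the simp set, where it would unfold forever; every loop below is handled by
  an induction that unfolds it explicitly, round by round.\<close>

lemma wp_While:
  "wp lt (While e c) s Q =
     (if eval_expr lt s e = NIL then Q (1 + expr_cost e) s
      else wp lt c s (\<lambda>k s'. wp lt (While e c) s' (\<lambda>l s''. Q (1 + expr_cost e + k + l) s'')))"
proof (cases "eval_expr lt s e = NIL")
  case True
  then have "exec lt (While e c) s k s' \<longleftrightarrow> k = 1 + expr_cost e \<and> s' = s" for k s'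
    by (subst exec_While_iff) auto
  with True show ?thesis
    unfolding wp_def by simp
next
  case False
  then have "exec lt (While e c) s k s' \<longleftrightarrow> (\<exists>k1 s1 k2. k = 1 + expr_cost e + k1 + k2 \<and>
      exec lt c s k1 s1 \<and> exec lt (While e c) s1 k2 s')" for k s'
    by (subst exec_While_iff) (simp add: conj_commute)
  with False show ?thesis
    unfolding wp_def by metis
qed

lemma wp_mono:
  assumes "wp lt c s Q" "\<And>k s'. Q k s' \<Longrightarrow> Q' k s'"
  shows "wp lt c s Q'"
  using assms unfolding wp_def by blast

lemma bool_tree_eq_NIL [simp]: "bool_tree b = NIL \<longleftrightarrow> \<not> b"
  by (simp add: bool_tree_def)

lemma list_tree_eq_NIL [simp]: "list_tree xs = NIL \<longleftrightarrow> xs = []"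
  by (cases xs) auto

subsection \<open>Sorting\<close>

definition push_all :: "nat \<Rightarrow> nat \<Rightarrow> cmd" where
  "push_all x y = While (EVar x)
     (Seq (Assign y (ECons (EHd (EVar x)) (EVar y))) (Assign x (ETl (EVar x))))"

text \<open>The count is exact: a round costs 2 for the guard and 5 + 3 for the assignments, and the
  failing guard at the end costs 2.\<close>

lemma wp_push_all:
  assumes "x \<noteq> y" "v x = list_tree xs" "v y = list_tree ys"
  shows "wp lt (push_all x y) (v, h) Q =
    Q (10 * length xs + 2) (v(x := NIL, y := list_tree (rev xs @ ys)), h)"
  using assms
proof (induction xs arbitrary: ys v Q)
  case Nil
  then have "v(x := NIL, y := list_tree ys) = v" by auto
  with Nil show ?case unfolding push_all_def by (subst wp_While) simp
next
  case (Cons a xs)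
  let ?v = "v(y := list_tree (a # ys), x := list_tree xs)"
  have "wp lt (push_all x y) (v, h) Q = wp lt (push_all x y) (?v, h) (\<lambda>k s. Q (10 + k) s)"
    unfolding push_all_def using Cons.prems by (subst wp_While) (simp add: fun_upd_twist numeral_eq_Suc)
  also have "\<dots> = Q (10 + (10 * length xs + 2)) (?v(x := NIL, y := list_tree (rev xs @ a # ys)), h)"
    using Cons.prems(1) by (subst Cons.IH[where ys = "a # ys"]) auto
  finally have exec_eq: "wp lt (push_all x y) (v, h) Q =
      Q (10 + (10 * length xs + 2)) (?v(x := NIL, y := list_tree (rev xs @ a # ys)), h)" .
  have upd: "?v(x := NIL, y := list_tree (rev xs @ a # ys)) = v(x := NIL, y := list_tree (rev xs @ a # ys))"
    using Cons.prems(1) by auto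
  have "rev (a # xs) @ ys = rev xs @ a # ys" "10 * length (a # xs) + 2 = 10 + (10 * length xs + 2)"
    by simp_all
  then show ?case unfolding exec_eq upd by metis
qed

section \<open>Merge sort on lists: merging two runs and pairing up all runs\<close>

fun merge :: "('a \<Rightarrow> 'a \<Rightarrow> bool) \<Rightarrow> 'a list \<Rightarrow> 'a list \<Rightarrow> 'a list" where
  "merge p [] ys = ys"
| "merge p (x # xs) [] = x # merge p xs []"
| "merge p (x # xs) (y # ys) =
     (if p x y then y # merge p (x # xs) ys else x # merge p xs (y # ys))"

lemma mset_merge [simp]: "mset (merge p xs ys) = mset xs + mset ys"
  by (induction p xs ys rule: merge.induct) auto

lemma set_merge [simp]: "set (merge p xs ys) = set xs \<union> set ys"
  by (metis mset_merge set_mset_mset set_mset_union)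

lemma length_merge [simp]: "length (merge p xs ys) = length xs + length ys"
  by (metis mset_merge size_mset size_union)

lemma merge_eq_Nil [simp]: "merge p xs ys = [] \<longleftrightarrow> xs = [] \<and> ys = []"
  by (metis Un_empty set_empty set_merge)

lemma Nil_eq_merge [simp]: "[] = merge p xs ys \<longleftrightarrow> xs = [] \<and> ys = []"
  by (metis merge_eq_Nil)

text \<open>The rank \<open>f\<close> into the naturals supplies linearity of the comparison;
  \<open>p\<close> only has to agree with it on the elements at hand. The element of larger rank
  goes first, so runs descend.\<close>

lemma sorted_merge:
  fixes f :: "'a \<Rightarrow> nat"
  assumes "\<And>x y. x \<in> set xs \<union> set ys \<Longrightarrow> y \<in> set xs \<union> set ys \<Longrightarrow> p x y \<longleftrightarrow> f x < f y"
    and "sorted_wrt (\<lambda>x y. f y \<le> f x) xs" "sorted_wrt (\<lambda>x y. f y \<le> f x) ys"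
  shows "sorted_wrt (\<lambda>x y. f y \<le> f x) (merge p xs ys)"
  using assms
proof (induction p xs ys rule: merge.induct)
  case (3 p x xs y ys)
  have xs: "sorted_wrt (\<lambda>x y. f y \<le> f x) xs" "\<forall>z\<in>set xs. f z \<le> f x"
    and ys: "sorted_wrt (\<lambda>x y. f y \<le> f x) ys" "\<forall>z\<in>set ys. f z \<le> f y"
    using 3(4,5) by auto
  show ?case
  proof (cases "p x y")
    case True
    have "sorted_wrt (\<lambda>x y. f y \<le> f x) (merge p (x # xs) ys)"
      by (rule 3(1)[OF True _ 3(4) ys(1)]) (rule 3(3); auto)
    moreover have "f x < f y"
      using True 3(3)[of x y] by simp
    ultimately show ?thesis
      using True xs ys by fastforce
  next
    case False
    have "sorted_wrt (\<lambda>x y. f y \<le> f x) (merge p xs (y # ys))"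
      by (rule 3(2)[OF False _ xs(1) 3(5)]) (rule 3(3); auto)
    moreover have "f y \<le> f x"
      using False 3(3)[of x y] by simp
    ultimately show ?thesis
      using False xs ys by fastforce
  qed
qed simp_all

text \<open>A last run without partner is merged with \<open>[]\<close> instead of being kept,
  because the program then finds \<open>NIL\<close> in place of the partner and merges all the
  same.\<close>

fun pair_up :: "('a \<Rightarrow> 'a \<Rightarrow> bool) \<Rightarrow> 'a list list \<Rightarrow> 'a list list" where
  "pair_up p [] = []"
| "pair_up p [xs] = [merge p xs []]"
| "pair_up p (xs # ys # zss) = merge p xs ys # pair_up p zss"

lemma mset_concat_pair_up [simp]: "mset (concat (pair_up p xss)) = mset (concat xss)"
  by (induction p xss rule: pair_up.induct) auto

lemma length_pair_up: "length (pair_up p xss) = (length xss + 1) div 2"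
  by (induction p xss rule: pair_up.induct) auto

lemma Nil_notin_pair_up: "[] \<notin> set xss \<Longrightarrow> [] \<notin> set (pair_up p xss)"
  by (induction p xss rule: pair_up.induct) auto

lemma sorted_pair_up:
  fixes f :: "'a \<Rightarrow> nat"
  assumes "\<And>x y. x \<in> set (concat xss) \<Longrightarrow> y \<in> set (concat xss) \<Longrightarrow> p x y \<longleftrightarrow> f x < f y"
    and "\<forall>xs\<in>set xss. sorted_wrt (\<lambda>x y. f y \<le> f x) xs"
  shows "\<forall>xs\<in>set (pair_up p xss). sorted_wrt (\<lambda>x y. f y \<le> f x) xs"
  using assms
proof (induction p xss rule: pair_up.induct)
  case (3 p xs ys zss)
  have "sorted_wrt (\<lambda>x y. f y \<le> f x) (merge p xs ys)"
    using 3 by (intro sorted_merge) auto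
  with 3 show ?case by auto
qed (auto intro: sorted_merge)

section \<open>Merge sort as a program\<close>

abbreviation run_tree :: "'v list \<Rightarrow> 'v tree" where
  "run_tree xs \<equiv> list_tree (map VAL xs)"

text \<open>Hash tables: 0 and 4 hold \<open>mn\<close> and \<open>mx\<close>, 2 marks the \<open>I\<close>-values seen, 3 holds the groups.
  Variables: 1 is the flag \<open>E = A\<close>, 2 the rest of the input, 3 and 4 the runs being merged, 5 their
  reversed merge, 6 and 7 the runs of the current and the next pass; 8, 9, 10 are the \<open>B\<close>-, \<open>E\<close>- and
  \<open>I\<close>-value of a tuple; 11 is the previously emitted \<open>B\<close>-value, 12 the failure flag, 13 the output.

  The runs are sorted in descending order of \<open>mn\<close>, so that the output can be built by consing.\<close>

definition merge_loop :: cmd where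
  "merge_loop = While (EVar 3)
     (If (ELess (EGet 0 (EHd (EVar 3))) (EGet 0 (EHd (EVar 4))))
        (Seq (Assign 5 (ECons (EHd (EVar 4)) (EVar 5))) (Assign 4 (ETl (EVar 4))))
        (Seq (Assign 5 (ECons (EHd (EVar 3)) (EVar 5))) (Assign 3 (ETl (EVar 3)))))"

abbreviation key_less :: "'v rel \<Rightarrow> (nat \<Rightarrow> 'v \<Rightarrow> 'v tree) \<Rightarrow> 'v \<Rightarrow> 'v \<Rightarrow> bool" where
  "key_less lt h x y \<equiv> less_val lt (h 0 x) (h 0 y)"

text \<open>When the second run is used up, its head and hence its key read as \<open>NIL\<close>.
  The comparison then fails and the first run is copied on, which is the second equation of
  \<open>merge\<close>.\<close>

lemma less_val_NIL [simp]: "\<not> less_val lt d NIL"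
  by (cases d) auto

text \<open>The loop stops as soon as the first run is empty, so a rest \<open>ys'\<close> of the
  second run may stay in variable 4, while \<open>acc'\<close> holds the front of the merge in
  reverse.\<close>

lemma wp_merge_loop:
  assumes "v 3 = run_tree xs" "v 4 = run_tree ys" "v 5 = run_tree acc"
  shows "wp lt merge_loop (v, h) (\<lambda>k s. k \<le> 20 * (length xs + length ys) + 2 \<and>
    (\<exists>acc' ys'. rev acc' @ ys' = rev acc @ merge (key_less lt h) xs ys \<and>
       s = (v(3 := NIL, 4 := run_tree ys', 5 := run_tree acc'), h)))"
  using assms
proof (induction "key_less lt h" xs ys arbitrary: v acc rule: merge.induct)
  case (1 ys)
  then have "v(3 := NIL, 4 := run_tree ys, 5 := run_tree acc) = v" by auto
  with 1 show ?case
    unfolding merge_loop_def by (subst wp_While) (simp, rule exI[of _ acc], rule exI[of _ ys], simp)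
next
  case (2 x xs)
  show ?case
    unfolding merge_loop_def
    apply (subst wp_While)
    apply (simp add: 2)
    apply (fold merge_loop_def)
    apply (rule wp_mono, rule 2(1)[where acc = "x # acc"])
    using 2 by (auto simp: fun_upd_twist)
next
  case (3 x xs y ys)
  show ?case
  proof (cases "key_less lt h x y")
    case True
    show ?thesis
      unfolding merge_loop_def
      apply (subst wp_While)
      apply (simp add: 3 True)
      apply (fold merge_loop_def)
      apply (rule wp_mono, rule 3(1)[OF True, where acc = "y # acc"])
      using 3(3-) True by (auto simp: fun_upd_twist)
  next
    case False
    show ?thesis
      unfolding merge_loop_def
      apply (subst wp_While)
      apply (simp add: 3 False)
      apply (fold merge_loop_def)
      apply (rule wp_mono, rule 3(2)[OF False, where acc = "x # acc"])
      using 3(3-) False by (auto simp: fun_upd_twist)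
  qed
qed

text \<open>Pushing the rest in 4 onto 5 completes the reversed merge; pushing everything back onto
  4 restores the descending order.\<close>

definition merge_runs :: cmd where
  "merge_runs = Seq merge_loop (Seq (push_all 4 5) (push_all 5 4))"

lemma wp_merge_runs:
  assumes "v 3 = run_tree xs" "v 4 = run_tree ys" "v 5 = NIL"
  shows "wp lt merge_runs (v, h) (\<lambda>k s. k \<le> 40 * (length xs + length ys) + 6 \<and>
    s = (v(3 := NIL, 4 := run_tree (merge (key_less lt h) xs ys), 5 := NIL), h))"
proof -
  have "wp lt (Seq (push_all 4 5) (push_all 5 4))
      (v(3 := NIL, 4 := run_tree ys', 5 := run_tree acc'), h)
      (\<lambda>l s. k + l \<le> 40 * (length xs + length ys) + 6 \<and>
        s = (v(3 := NIL, 4 := run_tree (merge (key_less lt h) xs ys), 5 := NIL), h))"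
    if k: "k \<le> 20 * (length xs + length ys) + 2"
      and eq: "rev acc' @ ys' = merge (key_less lt h) xs ys" for k acc' ys'
  proof -
    \<comment> \<open>Each of the two pushes costs at most 10 per element. With the 20 of the loop
      this makes 40, and the three failing guards make 6.\<close>
    have "length acc' + length ys' = length xs + length ys"
      using arg_cong[OF eq, of length] by simp
    then show ?thesis
      using k
      apply simp
      apply (subst wp_push_all[where xs = "map VAL ys'" and ys = "map VAL acc'"])
         apply simp_all
      apply (subst wp_push_all[where xs = "map VAL (rev ys' @ acc')" and ys = "[]"])
         apply (simp_all add: rev_map eq[symmetric] fun_upd_twist)
      done
  qed
  then show ?thesis
    unfolding merge_runs_def wp_Seq[of _ merge_loop]
    by (intro wp_mono[OF wp_merge_loop[of v xs ys "[]"]]) (use assms in auto)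
qed

definition merge_pass :: cmd where
  "merge_pass = While (EVar 6)
     (Seq (Assign 3 (EHd (EVar 6))) (Seq (Assign 6 (ETl (EVar 6)))
     (Seq (Assign 4 (EHd (EVar 6))) (Seq (Assign 6 (ETl (EVar 6)))
     (Seq (Assign 5 ENil) (Seq merge_runs (Assign 7 (ECons (EVar 4) (EVar 7)))))))))"

text \<open>The merged runs are stacked in variable 7, hence the \<open>rev\<close>. Apart from 40
  per element, a round costs 20 for guard and assignments and 6 for \<open>merge_runs\<close>, which
  gives the 26.\<close>

lemma wp_merge_pass:
  assumes "v 6 = list_tree (map run_tree xss)" "v 7 = list_tree (map run_tree yss)"
  shows "wp lt merge_pass (v, h) (\<lambda>k s.
    k \<le> 40 * length (concat xss) + 26 * length xss + 2 \<and> snd s = h \<and>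
    fst s 7 = list_tree (map run_tree (rev (pair_up (key_less lt h) xss) @ yss)))"
  using assms
proof (induction "key_less lt h" xss arbitrary: v yss rule: pair_up.induct)
  case 1
  then show ?case unfolding merge_pass_def by (subst wp_While) simp
next
  case (2 xs)
  show ?case
    unfolding merge_pass_def
    apply (subst wp_While)
    apply (simp add: 2)
    apply (rule wp_mono, rule wp_merge_runs[where xs = xs and ys = "[]"])
       apply (simp_all add: 2)
    apply (subst wp_While)
    apply (auto simp: 2)
    done
next
  case (3 xs ys zss)
  show ?case
    unfolding merge_pass_def
    apply (subst wp_While)
    apply (simp add: 3)
    apply (fold merge_pass_def)
    apply (rule wp_mono, rule wp_merge_runs[where xs = xs and ys = ys])
       apply (simp_all add: 3)
    apply (rule wp_mono, rule 3(1)[where yss = "merge (key_less lt h) xs ys # yss"])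
      apply (auto simp: 3)
    done
qed

text \<open>The guard holds iff at least two runs are left. The result is the head of variable 6,
  which is the empty run also when there was no run at all.\<close>

definition sort_runs :: cmd where
  "sort_runs = While (ETl (EVar 6))
     (Seq (Assign 7 ENil) (Seq merge_pass (Assign 6 (EVar 7))))"

lemma length_le_length_concat: "[] \<notin> set xss \<Longrightarrow> length xss \<le> length (concat xss)"
proof (induction xss)
  case (Cons xs xss)
  then show ?case by (cases xs) auto
qed simp

text \<open>A pass halves the number of runs, rounding up, and keeps the number of elements; so
  \<open>p\<close> passes suffice, each linear in the number of elements.\<close>

lemma wp_sort_runs:
  fixes f :: "'v \<Rightarrow> nat"
  assumes "v 6 = list_tree (map run_tree xss)" "[] \<notin> set xss" "length xss \<le> 2 ^ p"
    and "\<And>x y. x \<in> set (concat xss) \<Longrightarrow> y \<in> set (concat xss) \<Longrightarrow> key_less lt h x y \<longleftrightarrow> f x < f y"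
    and "\<forall>xs\<in>set xss. sorted_wrt (\<lambda>x y. f y \<le> f x) xs"
  shows "wp lt sort_runs (v, h) (\<lambda>k s. k \<le> p * (75 * length (concat xss)) + 3 \<and> snd s = h \<and>
    (\<exists>xs. hd_tree (fst s 6) = run_tree xs \<and> mset xs = mset (concat xss) \<and>
       sorted_wrt (\<lambda>x y. f y \<le> f x) xs))"
  using assms
proof (induction p arbitrary: v xss)
  case 0
  then consider "xss = []" | xs where "xss = [xs]"
    by (cases xss) auto
  then show ?case
    unfolding sort_runs_def using 0 by cases (subst wp_While, force)+
next
  case (Suc p)
  consider "xss = []" | xs where "xss = [xs]" | xs ys zss where "xss = xs # ys # zss"
    by (metis list.exhaust)
  then show ?case
  proof cases
    case 3
    let ?xss = "rev (pair_up (key_less lt h) xss)"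
    have pass: "[] \<notin> set ?xss" "length ?xss \<le> 2 ^ p"
      "\<forall>xs\<in>set ?xss. sorted_wrt (\<lambda>x y. f y \<le> f x) xs"
      using Suc.prems Nil_notin_pair_up[of xss] sorted_pair_up[of xss "key_less lt h" f]
      by (auto simp: length_pair_up)
    have mset: "mset (concat ?xss) = mset (concat xss)"
      using mset_concat_pair_up[of "key_less lt h" xss]
      by (simp add: mset_concat rev_map[symmetric] sum_list_rev del: mset_concat_pair_up)
    then have set: "set (concat ?xss) = set (concat xss)" and len: "length (concat ?xss) = length (concat xss)"
      by (metis set_mset_mset, metis size_mset)
    have "length xss \<le> length (concat xss)" "0 < length xss"
      using length_le_length_concat[OF Suc.prems(2)] 3 by simp_all
    \<comment> \<open>The 9 is 7 for the guard and the two assignments of a round, plus 2 for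
      leaving \<open>merge_pass\<close>. As runs are nonempty, there are at most as many runs as
      elements, and 40 + 26 + 9 = 75.\<close>
    then have cost: "40 * length (concat xss) + 26 * length xss + 9 \<le> 75 * length (concat xss)"
      by linarith
    have "wp lt sort_runs (v', h) (\<lambda>l s. k + l \<le> Suc p * (75 * length (concat xss)) + 3 \<and> snd s = h \<and>
        (\<exists>xs. hd_tree (fst s 6) = run_tree xs \<and> mset xs = mset (concat xss) \<and>
           sorted_wrt (\<lambda>x y. f y \<le> f x) xs))"
      if "k \<le> 75 * length (concat xss)" "v' 6 = list_tree (map run_tree ?xss)" for k v'
    proof (rule wp_mono, rule Suc.IH[of v' ?xss, OF that(2) pass(1,2) _ pass(3)])
      show "key_less lt h x y \<longleftrightarrow> f x < f y" if "x \<in> set (concat ?xss)" "y \<in> set (concat ?xss)" for x y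
        using that Suc.prems(4) unfolding set by blast
    qed (use mset len that in auto)
    note loop = this
    have nonempty: "tl_tree (v 6) \<noteq> NIL"
      using Suc.prems(1) 3 by simp
    show ?thesis
      unfolding sort_runs_def
      apply (subst wp_While)
      apply (simp add: nonempty)
      apply (fold sort_runs_def)
      apply (rule wp_mono, rule wp_merge_pass[where xss = xss and yss = "[]"])
        apply (simp_all add: Suc.prems)
      subgoal for k s'
        apply (cases s')
        apply (simp del: concat.simps pair_up.simps)
        apply (rule wp_mono, rule loop[where k = "k+7"])
        using cost apply auto
        done
      done
  next
    case 1
    then show ?thesis
      unfolding sort_runs_def using Suc.prems by (subst wp_While) auto
  next
    case (2 xs)
    then show ?thesis
      unfolding sort_runs_def using Suc.prems by (subst wp_While) (auto intro!: exI[of _ xs])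
  qed
qed

subsection \<open>Output of the groups\<close>

definition emit_groups :: cmd where
  "emit_groups = While (EVar 3)
     (Seq (Assign 8 (EHd (EVar 3))) (Seq (Assign 3 (ETl (EVar 3)))
     (Seq (If (EVar 11)
             (If (ELess (EGet 4 (EVar 8)) (EGet 0 (EVar 11))) Skip (Assign 12 (ECons ENil ENil)))
             Skip)
     (Seq (Assign 13 (ECons (EGet 3 (EVar 8)) (EVar 13))) (Assign 11 (EVar 8))))))"
text \<open>\<open>nxt\<close> is the \<open>B\<close>-value emitted just before, that is, the upper
  neighbour when the list descends. The flag 12 is never lowered inside the loop, so it remembers a
  failure at any pair of neighbours.\<close>

lemma wp_emit_groups:
  assumes "v 3 = run_tree bs" "v 11 = (case nxt of None \<Rightarrow> NIL | Some x \<Rightarrow> VAL x)"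
    and "v 13 = list_tree out"
  shows "wp lt emit_groups (v, h) (\<lambda>k s. k \<le> 30 * length bs + 2 \<and>
    fst s 13 = list_tree (rev (map (h 3) bs) @ out) \<and>
    (fst s 12 = NIL \<longleftrightarrow> v 12 = NIL \<and>
       successively (\<lambda>x y. less_val lt (h 4 y) (h 0 x)) (case nxt of None \<Rightarrow> bs | Some x \<Rightarrow> x # bs)))"
  using assms
proof (induction bs arbitrary: v nxt out)
  case Nil
  then show ?case unfolding emit_groups_def by (subst wp_While) (auto split: option.split)
next
  case (Cons b bs)
  show ?case
  proof (cases nxt)
    case None
    show ?thesis
      unfolding emit_groups_def
      apply (subst wp_While)
      apply (simp add: Cons.prems None)
      apply (fold emit_groups_def)
      apply (rule wp_mono, rule Cons.IH[where nxt = "Some b" and out = "h 3 b # out"])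
         apply (auto simp: Cons.prems None)
      done
  next
    case (Some x)
    show ?thesis
      unfolding emit_groups_def
      apply (subst wp_While)
      apply (simp add: Cons.prems Some)
      apply (fold emit_groups_def)
      apply (intro conjI impI)
       apply (rule wp_mono, rule Cons.IH[where nxt = "Some b" and out = "h 3 b # out"])
          apply (auto simp: Cons.prems Some)[4]
      apply (rule wp_mono, rule Cons.IH[where nxt = "Some b" and out = "h 3 b # out"])
         apply (auto simp: Cons.prems Some)
      done
  qed
qed

subsection \<open>Scanning the table\<close>

text \<open>\<open>K\<close> is the \<open>E\<close>-value and \<open>G\<close> the
  \<open>B\<close>-value of a tuple. With \<open>lt\<close> this describes \<open>mn\<close>, with
  \<open>lt\<inverse>\<close> it describes \<open>mx\<close>. \<open>NIL\<close>, the default of a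
  hash table, tells that a \<open>B\<close>-value has not been met.\<close>

definition least_table :: "'v rel \<Rightarrow> ('t \<Rightarrow> 'v) \<Rightarrow> ('t \<Rightarrow> 'v) \<Rightarrow> 't set \<Rightarrow> ('v \<Rightarrow> 'v tree) \<Rightarrow> bool" where
  "least_table lt K G S m \<longleftrightarrow>
     (\<forall>b. b \<notin> G ` S \<longrightarrow> m b = NIL) \<and>
     (\<forall>b\<in>G ` S. \<exists>t\<in>S. G t = b \<and> m b = VAL (K t) \<and> (\<forall>u\<in>S. G u = b \<longrightarrow> (K u, K t) \<notin> lt))"

lemma least_table_insert_new:
  assumes "irrefl lt" "least_table lt K G S m" "G t \<notin> G ` S"
  shows "least_table lt K G (insert t S) (m(G t := VAL (K t)))"
  using assms unfolding least_table_def irrefl_def by (auto simp: image_iff)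

lemma least_table_insert_old:
  assumes "trans lt" "irrefl lt" "least_table lt K G S m" "m (G t) = VAL k"
  shows "least_table lt K G (insert t S) (if (K t, k) \<in> lt then m(G t := VAL (K t)) else m)"
proof -
  obtain u where u: "u \<in> S" "G u = G t" "K u = k" "\<And>w. w \<in> S \<Longrightarrow> G w = G t \<Longrightarrow> (K w, k) \<notin> lt"
    using assms(3,4) unfolding least_table_def by (metis tree.inject(1) tree.distinct(1))
  have least: "\<exists>t'\<in>insert t S. G t' = b \<and> (if (K t, k) \<in> lt then m(G t := VAL (K t)) else m) b = VAL (K t')
      \<and> (\<forall>w\<in>insert t S. G w = b \<longrightarrow> (K w, K t') \<notin> lt)" if b: "b \<in> G ` insert t S" for b
  proof (cases "b = G t")
    case True
    show ?thesis
    proof (cases "(K t, k) \<in> lt")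
      case less: True
      \<comment> \<open>An older tuple of the group with a key below the new one would, by
        transitivity, have a key below the old minimum \<open>k\<close>.\<close>
      have "(K w, K t) \<notin> lt" if "w \<in> insert t S" "G w = b" for w
        using that u(4)[of w] less assms(1,2) True by (metis insertE irrefl_def transD)
      then show ?thesis using True less by (intro bexI[of _ t]) auto
    next
      case False
      then show ?thesis using True u assms(4) by (intro bexI[of _ u]) auto
    qed
  next
    case False
    then obtain t' where "t' \<in> S" "G t' = b" "m b = VAL (K t')" "\<forall>u\<in>S. G u = b \<longrightarrow> (K u, K t') \<notin> lt"
      using assms(3) b unfolding least_table_def by auto
    with False show ?thesis by (intro bexI[of _ t']) auto
  qed
  then show ?thesis
    using assms(3) unfolding least_table_def by auto
qed

text \<open>The marks in \<open>seen\<close> keep the groups free of duplicates in constant time,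
  with one mark per \<open>I\<close>-value. An untouched bucket is \<open>NIL\<close>, which also
  encodes the empty list.\<close>

definition bucket_table ::
    "('t \<Rightarrow> 'v) \<Rightarrow> ('t \<Rightarrow> 'v) \<Rightarrow> 't set \<Rightarrow> ('v \<Rightarrow> 'v tree) \<Rightarrow> ('v \<Rightarrow> 'v tree) \<Rightarrow> bool" where
  "bucket_table I G S seen bucket \<longleftrightarrow>
     (\<forall>x. seen x = NIL \<longleftrightarrow> x \<notin> I ` S) \<and>
     (\<forall>b. \<exists>xs. bucket b = run_tree xs \<and> distinct xs \<and> set xs = I ` {t \<in> S. G t = b})"

lemma bucket_table_insert_new:
  assumes "bucket_table I G S seen bucket" "seen (I t) = NIL"
  shows "bucket_table I G (insert t S) (seen(I t := CONS NIL NIL))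
    (bucket(G t := CONS (VAL (I t)) (bucket (G t))))"
proof -
  have "\<exists>xs. (bucket(G t := CONS (VAL (I t)) (bucket (G t)))) b = run_tree xs \<and> distinct xs \<and>
      set xs = I ` {u \<in> insert t S. G u = b}" for b
  proof -
    obtain xs where xs: "bucket b = run_tree xs" "distinct xs" "set xs = I ` {u \<in> S. G u = b}"
      using assms(1) unfolding bucket_table_def by blast
    have new: "I t \<notin> I ` S"
      using assms unfolding bucket_table_def by blast
    show ?thesis
    proof (cases "b = G t")
      case True
      then have "{u \<in> insert t S. G u = b} = insert t {u \<in> S. G u = b}" by auto
      with True xs new show ?thesis
        by (intro exI[of _ "I t # xs"]) (auto simp: image_iff)
    next
      case False
      then have "{u \<in> insert t S. G u = b} = {u \<in> S. G u = b}" by auto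
      with False xs show ?thesis by (intro exI[of _ xs]) simp
    qed
  qed
  moreover have "\<forall>x. (seen(I t := CONS NIL NIL)) x = NIL \<longleftrightarrow> x \<notin> I ` insert t S"
    using assms(1) unfolding bucket_table_def by simp
  ultimately show ?thesis
    unfolding bucket_table_def by blast
qed

text \<open>The mark does not say which bucket received the value; since the \<open>I\<close>-value
  determines the group, it can only have been the bucket of \<open>G t\<close>.\<close>

lemma bucket_table_insert_old:
  assumes "bucket_table I G S seen bucket" "seen (I t) \<noteq> NIL" "\<And>u. u \<in> S \<Longrightarrow> I u = I t \<Longrightarrow> G u = G t"
  shows "bucket_table I G (insert t S) seen bucket"
proof -
  have "I t \<in> I ` S"
    using assms(1,2) unfolding bucket_table_def by blast
  then obtain u where "u \<in> S" "I u = I t"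
    by auto
  then have "I t \<in> I ` {w \<in> S. G w = G t}"
    using assms(3) by (intro image_eqI[of _ _ u]) auto
  then have "I ` {w \<in> insert t S. G w = b} = I ` {w \<in> S. G w = b}" "I ` insert t S = I ` S" for b
    by auto
  with assms(1) show ?thesis
    unfolding bucket_table_def by simp
qed

text \<open>The invariant of the scan. \<open>d\<close> is the content of variable 6: one singleton
  run per distinct \<open>B\<close>-value, so that the sort starts with m elements and not with
  n.\<close>

definition scanned ::
    "'v rel \<Rightarrow> ('t \<Rightarrow> 'v) \<Rightarrow> ('t \<Rightarrow> 'v) \<Rightarrow> ('t \<Rightarrow> 'v) \<Rightarrow> 't set \<Rightarrow> 'v tree \<Rightarrow> (nat \<Rightarrow> 'v \<Rightarrow> 'v tree) \<Rightarrow> bool" where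
  "scanned lt K G I S d h \<longleftrightarrow>
     least_table lt K G S (h 0) \<and> least_table (lt\<inverse>) K G S (h 4) \<and> bucket_table I G S (h 2) (h 3) \<and>
     (\<exists>bs. d = list_tree (map (\<lambda>b. run_tree [b]) bs) \<and> distinct bs \<and> set bs = G ` S)"

text \<open>The second component of a pair is always the \<open>B\<close>-value; the flag in
  variable 1 decides which component is the \<open>E\<close>-value. \<open>NIL\<close> in table 0
  reveals a new \<open>B\<close>-value, which then opens a run; \<open>NIL\<close> in table 2
  reveals a new \<open>I\<close>-value.\<close>

definition scan_tuple :: cmd where
  "scan_tuple =
     (Seq (Assign 8 (ETl (EHd (EVar 2))))
     (Seq (If (EVar 1)
             (Seq (Assign 9 (EHd (EHd (EVar 2)))) (Assign 10 (EVar 8)))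
             (Seq (Assign 9 (EVar 8)) (Assign 10 (EHd (EHd (EVar 2))))))
     (Seq (Assign 2 (ETl (EVar 2)))
     (Seq (If (EGet 0 (EVar 8))
             (Seq (If (ELess (EVar 9) (EGet 0 (EVar 8))) (Put 0 (EVar 8) (EVar 9)) Skip)
                (If (ELess (EGet 4 (EVar 8)) (EVar 9)) (Put 4 (EVar 8) (EVar 9)) Skip))
             (Seq (Put 0 (EVar 8) (EVar 9)) (Seq (Put 4 (EVar 8) (EVar 9))
                (Assign 6 (ECons (ECons (EVar 8) ENil) (EVar 6))))))
          (If (EGet 2 (EVar 10)) Skip
             (Seq (Put 2 (EVar 10) (ECons ENil ENil))
                (Put 3 (EVar 8) (ECons (EVar 10) (EGet 3 (EVar 8))))))))))"

lemma wp_scan_tuple: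
  assumes lt: "trans lt" "irrefl lt"
    and S: "scanned lt K G I S (v 6) h" "\<And>u. u \<in> S \<Longrightarrow> I u = I t \<Longrightarrow> G u = G t"
    and v: "v 2 = CONS (CONS (VAL a) (VAL (G t))) d"
      "if v 1 = NIL then K t = G t \<and> I t = a else K t = a \<and> I t = G t"
  shows "wp lt scan_tuple (v, h) (\<lambda>k s. k \<le> 60 \<and> fst s 1 = v 1 \<and> fst s 2 = d \<and>
    scanned lt K G I (insert t S) (fst s 6) (snd s))"
proof -
  have conv: "trans (lt\<inverse>)" "irrefl (lt\<inverse>)"
    using lt by (auto simp: irrefl_def)
  obtain bs where bs: "v 6 = list_tree (map (\<lambda>b. run_tree [b]) bs)" "distinct bs" "set bs = G ` S"
    and least: "least_table lt K G S (h 0)" "least_table (lt\<inverse>) K G S (h 4)"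
    and bucket: "bucket_table I G S (h 2) (h 3)"
    using S(1) unfolding scanned_def by blast
  have bucket': "h 2 (I t) = NIL \<Longrightarrow> bucket_table I G (insert t S) ((h 2)(I t := CONS NIL NIL))
        ((h 3)(G t := CONS (VAL (I t)) (h 3 (G t))))"
    "h 2 (I t) \<noteq> NIL \<Longrightarrow> bucket_table I G (insert t S) (h 2) (h 3)"
    using bucket_table_insert_new[OF bucket, of t] bucket_table_insert_old[OF bucket, of t] S(2) by auto
  show ?thesis
  proof (cases "G t \<in> G ` S")
    case True
    then obtain k0 k1 where k: "h 0 (G t) = VAL k0" "h 4 (G t) = VAL k1"
      using least unfolding least_table_def by meson
    have "G ` insert t S = G ` S" using True by auto
    with bs have bs': "\<exists>bs. v 6 = list_tree (map (\<lambda>b. run_tree [b]) bs) \<and> distinct bs \<and> set bs = G ` insert t S"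
      by auto
    note least' = least_table_insert_old[OF lt least(1) k(1)] least_table_insert_old[OF conv least(2) k(2)]
    show ?thesis
      using v(2) least' bucket'
      by (cases "v 1 = NIL"; cases "h 2 (I t) = NIL"; cases "(K t, k0) \<in> lt"; cases "(k1, K t) \<in> lt")
        (simp_all add: scan_tuple_def scanned_def v(1) k bs'[simplified])
  next
    case False
    then have k: "h 0 (G t) = NIL" "h 4 (G t) = NIL"
      using least unfolding least_table_def by auto
    have bs': "\<exists>bs'. CONS (CONS (VAL (G t)) NIL) (v 6) = list_tree (map (\<lambda>b. run_tree [b]) bs')
        \<and> distinct bs' \<and> set bs' = G ` insert t S"
      using bs False by (intro exI[of _ "G t # bs"]) auto
    note least' = least_table_insert_new[OF lt(2) least(1) False] least_table_insert_new[OF conv(2) least(2) False]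
    show ?thesis
      using v(2) least' bucket'
      by (cases "v 1 = NIL"; cases "h 2 (I t) = NIL")
        (simp_all add: scan_tuple_def scanned_def v(1) k bs'[simplified])
  qed
qed

definition scan_table :: cmd where
  "scan_table = While (EVar 2) scan_tuple"

lemma wp_scan_table:
  assumes lt: "trans lt" "irrefl lt"
    and "v 2 = list_tree (map (\<lambda>t. CONS (VAL (a t)) (VAL (G t))) ts)"
    and "scanned lt K G I S (v 6) h"
    and fd: "\<And>s t. s \<in> S \<union> set ts \<Longrightarrow> t \<in> S \<union> set ts \<Longrightarrow> I s = I t \<Longrightarrow> G s = G t"
    and "\<And>t. if v 1 = NIL then K t = G t \<and> I t = a t else K t = a t \<and> I t = G t"
  shows "wp lt scan_table (v, h) (\<lambda>k s. k \<le> 62 * length ts + 2 \<and>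
    scanned lt K G I (S \<union> set ts) (fst s 6) (snd s))"
  using assms(3-)
proof (induction ts arbitrary: S v h)
  case Nil
  then show ?case unfolding scan_table_def by (subst wp_While) simp
next
  case (Cons t ts)
  have tuple: "wp lt scan_tuple (v, h) (\<lambda>k s. k \<le> 60 \<and> fst s 1 = v 1 \<and>
      fst s 2 = list_tree (map (\<lambda>t. CONS (VAL (a t)) (VAL (G t))) ts) \<and>
      scanned lt K G I (insert t S) (fst s 6) (snd s))"
    by (rule wp_scan_tuple[where v = v and S = S and h = h, OF lt Cons.prems(2)])
      (use Cons.prems(1,4) in \<open>auto intro: Cons.prems(3)\<close>)
  have rest: "wp lt scan_table s (\<lambda>l s'. 2 + k + l \<le> 62 * length (t # ts) + 2 \<and>
      scanned lt K G I (S \<union> set (t # ts)) (fst s' 6) (snd s'))"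
    if "k \<le> 60" "fst s 1 = v 1" "fst s 2 = list_tree (map (\<lambda>t. CONS (VAL (a t)) (VAL (G t))) ts)"
      "scanned lt K G I (insert t S) (fst s 6) (snd s)" for k s
  proof -
    have "wp lt scan_table (fst s, snd s) (\<lambda>k s'. k \<le> 62 * length ts + 2 \<and>
        scanned lt K G I (insert t S \<union> set ts) (fst s' 6) (snd s'))"
    proof (rule Cons.IH[OF that(3,4)])
      show "G u = G w" if "u \<in> insert t S \<union> set ts" "w \<in> insert t S \<union> set ts" "I u = I w" for u w
        using that Cons.prems(3)[of u w] by auto
      show "if fst s 1 = NIL then K u = G u \<and> I u = a u else K u = a u \<and> I u = G u" for u
        using Cons.prems(4)[of u] \<open>fst s 1 = v 1\<close> by simp
    qed
    then show ?thesis
      unfolding prod.collapse by (rule wp_mono) (use that(1) in auto)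
  qed
  have "eval_expr lt (v, h) (EVar 2) \<noteq> NIL"
    using Cons.prems(1) by simp
  then show ?case
    unfolding scan_table_def
    apply (subst wp_While)
    apply (simp only: if_False)
    apply (rule wp_mono[OF tuple])
    apply (fold scan_table_def)
    apply (rule wp_mono, rule rest)
        apply auto
    done
qed

subsection \<open>Derived orders and witnesses\<close>

lemma list_order_Nil [simp]: "list_order [] = {}"
  by (simp add: list_order_def)

lemma list_order_Cons [simp]: "list_order (x # xs) = {x} \<times> set xs \<union> list_order xs"
proof -
  have "(a, b) \<in> list_order (x # xs) \<longleftrightarrow> a = x \<and> b \<in> set xs \<or> (a, b) \<in> list_order xs" for a b
  proof
    assume "(a, b) \<in> list_order (x # xs)"
    then obtain i j where ij: "a = (x # xs) ! i" "b = (x # xs) ! j" "i < j" "j < length (x # xs)"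
      unfolding list_order_def by blast
    then obtain j' where j': "j = Suc j'" by (cases j) auto
    show "a = x \<and> b \<in> set xs \<or> (a, b) \<in> list_order xs"
      using ij j' unfolding list_order_def by (cases i) auto
  next
    assume "a = x \<and> b \<in> set xs \<or> (a, b) \<in> list_order xs"
    then show "(a, b) \<in> list_order (x # xs)"
    proof
      assume "a = x \<and> b \<in> set xs"
      then obtain j where "a = (x # xs) ! 0" "b = (x # xs) ! Suc j" "j < length xs"
        by (auto simp: in_set_conv_nth)
      then show ?thesis unfolding list_order_def by fastforce
    next
      assume "(a, b) \<in> list_order xs"
      then obtain i j where "a = (x # xs) ! Suc i" "b = (x # xs) ! Suc j" "i < j" "j < length xs"
        unfolding list_order_def by auto
      then show ?thesis unfolding list_order_def by fastforce
    qed
  qed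
  then show ?thesis by auto
qed

lemma list_order_subset: "list_order xs \<subseteq> set xs \<times> set xs"
  by (induction xs) auto

lemma list_order_asym: "distinct xs \<Longrightarrow> (x, y) \<in> list_order xs \<Longrightarrow> (y, x) \<notin> list_order xs"
proof (induction xs)
  case (Cons a xs)
  then show ?case using list_order_subset[of xs] by auto
qed simp

text \<open>Collapsing only merges repetitions, so it can lose no pairs except those of the form
  \<open>(x, x)\<close>.\<close>

lemma list_order_remdups_adj:
  "x \<noteq> y \<Longrightarrow> (x, y) \<in> list_order (remdups_adj xs) \<longleftrightarrow> (x, y) \<in> list_order xs"
  by (induction xs rule: remdups_adj.induct) auto

lemma list_order_map: "list_order (map f xs) = {(f x, f y) | x y. (x, y) \<in> list_order xs}"
  by (induction xs) auto

lemma list_order_sorted_wrt: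
  assumes "irrefl T" "trans T" "sorted_wrt (\<lambda>x y. (x, y) \<in> T) xs"
  shows "list_order xs = {(x, y) \<in> T. x \<in> set xs \<and> y \<in> set xs}"
  using assms(3)
proof (induction xs)
  case (Cons a xs)
  have "(a, a) \<notin> T" "(x, a) \<notin> T" if "x \<in> set xs" for x
    using assms(1,2) Cons.prems that by (auto simp: irrefl_def dest: transD)
  with Cons show ?case using assms(1) by (auto simp: irrefl_def)
qed simp

text \<open>Equal values are adjacent, since a value returning after a different one would lie both
  below and above it.\<close>

lemma distinct_remdups_adj_sorted_wrt:
  assumes "irrefl W" "trans W" "sorted_wrt (\<lambda>x y. x = y \<or> (x, y) \<in> W) xs"
  shows "distinct (remdups_adj xs)"
  using assms(3)
proof (induction xs rule: remdups_adj.induct)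
  case (3 x y xs)
  show ?case
  proof (cases "x = y")
    case False
    then have "(x, y) \<in> W" using 3 by simp
    have "x \<notin> set (y # xs)"
    proof
      assume "x \<in> set (y # xs)"
      then have "(y, x) \<in> W" using 3(3) False by auto
      with \<open>(x, y) \<in> W\<close> show False using assms(1,2) by (meson irrefl_def transD)
    qed
    with False 3 show ?thesis by simp
  qed (use 3 in simp)
qed simp_all

section \<open>Witnesses, the orders they derive, and the intersection of these orders\<close>

lemma listing_properties:
  assumes "finite A" "strict_linear_order_on A T"
  shows "distinct (listing A T)" "set (listing A T) = A" "sorted_wrt (\<lambda>x y. (x, y) \<in> T) (listing A T)"
  using theI'[OF ex1_listing[OF assms]] unfolding listing_def by blast+

text \<open>Reduces derived orders to pairs of positions, so that listings and collapsing disappear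
  from the later arguments.\<close>

lemma witness_derived_order:
  assumes "witness r E lt I T"
  shows "(x, y) \<in> derived_order r I T \<longleftrightarrow>
    x \<noteq> y \<and> (\<exists>i<length r. \<exists>j<length r. (i, j) \<in> T \<and> (r ! i) I = x \<and> (r ! j) I = y)"
proof -
  let ?l = "listing {..<length r} T"
  have T: "strict_linear_order_on {..<length r} T" and "distinct (collapsed_column r I T)"
    using assms unfolding witness_def projects_def by auto
  then have "x \<noteq> y" if "(x, y) \<in> derived_order r I T"
    using that list_order_asym unfolding derived_order_def by metis
  moreover have "(x, y) \<in> derived_order r I T \<longleftrightarrow> (x, y) \<in> list_order (map (\<lambda>i. (r ! i) I) ?l)" if "x \<noteq> y"
    unfolding derived_order_def collapsed_column_def using list_order_remdups_adj[OF that] .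
  moreover have "list_order ?l = {(i, j) \<in> T. i < length r \<and> j < length r}"
    using listing_properties[OF _ T] T unfolding strict_linear_order_on_def
    by (subst list_order_sorted_wrt[of T]) auto
  ultimately show ?thesis
    unfolding list_order_map by auto
qed

lemma witness_derived_order_asym:
  assumes "witness r E lt I T" "(x, y) \<in> derived_order r I T"
  shows "(y, x) \<notin> derived_order r I T"
  using assms list_order_asym unfolding witness_def projects_def derived_order_def by metis

text \<open>The witness sorts the tuples by their \<open>I\<close>-value with respect to \<open>W\<close>, and breaks ties by the
  \<open>E\<close>-value.\<close>

lemma ex_witness:
  assumes lt: "strict_linear_order_on (column_values r E) lt"
    and W: "trans W" "irrefl W" "total_on (column_values r I) W"
    and compat: "\<And>s t. s \<in> set r \<Longrightarrow> t \<in> set r \<Longrightarrow> (s E, t E) \<in> lt \<Longrightarrow> (t I, s I) \<notin> W"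
  shows "\<exists>T. witness r E lt I T \<and> (\<forall>i j. ((r ! i) I, (r ! j) I) \<in> W \<longrightarrow> (i, j) \<in> T)"
proof -
  \<comment> \<open>The position comes last, to separate tuples that agree on both
    attributes.\<close>
  define T where "T = inv_image (W <*lex*> lt <*lex*> less_than) (\<lambda>i. ((r ! i) I, (r ! i) E, i))"
  have lt': "trans lt" "irrefl lt" "total_on (column_values r E) lt"
    using lt by (auto simp: strict_linear_order_on_def)
  have col: "(r ! i) C \<in> column_values r C" if "i < length r" for i C
    using that by (auto simp: column_values_def)
  have trans: "trans T"
    unfolding T_def using W(1) lt'(1) by (intro trans_inv_image trans_lex_prod trans_less_than)
  have irrefl: "irrefl T"
    using W(2) lt'(2) by (auto simp: T_def irrefl_def)
  have total: "total_on {..<length r} T"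
  proof (rule total_onI)
    fix i j assume ij: "i \<in> {..<length r}" "j \<in> {..<length r}" "i \<noteq> j"
    have "(r ! i) I = (r ! j) I \<or> ((r ! i) I, (r ! j) I) \<in> W \<or> ((r ! j) I, (r ! i) I) \<in> W"
      using W(3) col[of i I] col[of j I] ij unfolding total_on_def by blast
    moreover have "(r ! i) E = (r ! j) E \<or> ((r ! i) E, (r ! j) E) \<in> lt \<or> ((r ! j) E, (r ! i) E) \<in> lt"
      using lt'(3) col[of i E] col[of j E] ij unfolding total_on_def by blast
    ultimately show "(i, j) \<in> T \<or> (j, i) \<in> T"
      using ij(3) by (auto simp: T_def)
  qed
  have slo: "strict_linear_order_on {..<length r} T"
    using trans irrefl total by (simp add: strict_linear_order_on_def)
  \<comment> \<open>\<open>compat\<close> excludes the reversed order of the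
    \<open>I\<close>-values. Totality of \<open>W\<close> leaves the right order, or equal
    \<open>I\<close>-values, where the \<open>E\<close>-values decide.\<close>
  have explicit: "(i, j) \<in> T" if "i < length r" "j < length r" "((r ! i) E, (r ! j) E) \<in> lt" for i j
  proof -
    have "((r ! j) I, (r ! i) I) \<notin> W"
      using compat[of "r ! i" "r ! j"] that by simp
    then have "(r ! i) I = (r ! j) I \<or> ((r ! i) I, (r ! j) I) \<in> W"
      using W(3) col[of i I] col[of j I] that unfolding total_on_def by blast
    with that show ?thesis by (auto simp: T_def)
  qed
  have "sorted_wrt (\<lambda>x y. x = y \<or> (x, y) \<in> W) (map (\<lambda>i. (r ! i) I) (listing {..<length r} T))"
    using listing_properties(3)[OF _ slo]
    by (auto simp: sorted_wrt_map T_def elim!: sorted_wrt_mono_rel[rotated])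
  then have "projects r I T"
    unfolding projects_def collapsed_column_def using W(1,2) by (intro distinct_remdups_adj_sorted_wrt)
  with slo explicit have "witness r E lt I T"
    unfolding witness_def by blast
  then show ?thesis
    by (intro exI[of _ T]) (simp add: T_def)
qed

text \<open>\<gamma> numbers the groups. By \<open>less\<close>, every witness must respect the
  order between groups; by \<open>eq\<close>, a group can be arranged in any way. So exactly the
  comparisons by \<gamma> survive the intersection.\<close>

lemma strongest_derivable_order_eq:
  fixes \<gamma> :: "'v \<Rightarrow> nat"
  assumes lt: "strict_linear_order_on (column_values r E) lt"
    and less: "\<And>s t. s \<in> set r \<Longrightarrow> t \<in> set r \<Longrightarrow> \<gamma> (s I) < \<gamma> (t I) \<Longrightarrow> (s E, t E) \<in> lt"
    and eq: "\<And>s t. s \<in> set r \<Longrightarrow> t \<in> set r \<Longrightarrow> \<gamma> (s I) = \<gamma> (t I) \<Longrightarrow> s I = t I \<or> s E = t E"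
  shows "ei_oc_valid r E lt I"
    and "strongest_derivable_order r E lt I =
      {(x, y). x \<in> column_values r I \<and> y \<in> column_values r I \<and> \<gamma> x < \<gamma> y}"
proof -
  have lt': "trans lt" "irrefl lt"
    using lt by (auto simp: strict_linear_order_on_def)
  \<comment> \<open>Sorting by \<gamma> and then by an arbitrary injective \<open>q\<close> yields a
    witness. Some \<open>q\<close> proves validity; a modified one later reverses a pair inside a
    group.\<close>
  have witness: "\<exists>T. witness r E lt I T \<and>
      (\<forall>i j. \<gamma> ((r ! i) I) = \<gamma> ((r ! j) I) \<and> q ((r ! i) I) < q ((r ! j) I) \<longrightarrow> (i, j) \<in> T)"
    if q: "inj_on q (column_values r I)" for q :: "'v \<Rightarrow> nat"
  proof -
    let ?W = "{(x, y). \<gamma> x < \<gamma> y \<or> \<gamma> x = \<gamma> y \<and> q x < q y}"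
    have "trans ?W" "irrefl ?W"
      by (auto intro!: transI irreflI)
    moreover have "total_on (column_values r I) ?W"
    proof (rule total_onI)
      fix x y assume "x \<in> column_values r I" "y \<in> column_values r I" "x \<noteq> y"
      with q have "q x \<noteq> q y"
        by (simp add: inj_on_eq_iff)
      then show "(x, y) \<in> ?W \<or> (y, x) \<in> ?W"
        by auto
    qed
    ultimately have W: "trans ?W" "irrefl ?W" "total_on (column_values r I) ?W" .
    have "(t I, s I) \<notin> ?W" if "s \<in> set r" "t \<in> set r" "(s E, t E) \<in> lt" for s t
    proof
      assume W: "(t I, s I) \<in> ?W"
      have "(t E, s E) \<notin> lt"
        using that(3) lt' by (meson irrefl_def transD)
      moreover have "t E \<noteq> s E"
        using that(3) lt'(2) by (auto simp: irrefl_def)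
      ultimately show False
        using W less[OF that(2,1)] eq[OF that(2,1)] by auto
    qed
    then have "\<exists>T. witness r E lt I T \<and> (\<forall>i j. ((r ! i) I, (r ! j) I) \<in> ?W \<longrightarrow> (i, j) \<in> T)"
      by (intro ex_witness[OF lt W])
    then show ?thesis
      by simp blast
  qed
  have "finite (column_values r I)"
    by (simp add: column_values_def)
  then obtain q :: "'v \<Rightarrow> nat" where q: "inj_on q (column_values r I)"
    using finite_imp_inj_to_nat_seg[of "column_values r I"] by blast
  from witness[OF q] obtain T\<^sub>0 where T\<^sub>0: "witness r E lt I T\<^sub>0" by blast
  then show "ei_oc_valid r E lt I"
    unfolding ei_oc_valid_def by blast
  show "strongest_derivable_order r E lt I =
      {(x, y). x \<in> column_values r I \<and> y \<in> column_values r I \<and> \<gamma> x < \<gamma> y}" (is "_ = ?R")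
  proof (intro subset_antisym subrelI)
    fix x y assume "(x, y) \<in> ?R"
    then have "\<exists>i<length r. (r ! i) I = x" "\<exists>j<length r. (r ! j) I = y" and "\<gamma> x < \<gamma> y"
      by (auto simp: column_values_def in_set_conv_nth)
    then obtain i j where ij: "i < length r" "j < length r" "(r ! i) I = x" "(r ! j) I = y" "\<gamma> x < \<gamma> y"
      by blast
    then have "((r ! i) E, (r ! j) E) \<in> lt"
      using less[of "r ! i" "r ! j"] by simp
    then have "(x, y) \<in> derived_order r I T" if "witness r E lt I T" for T
    proof -
      have "(i, j) \<in> T"
        using that ij(1,2) \<open>((r ! i) E, (r ! j) E) \<in> lt\<close> unfolding witness_def by blast
      moreover have "x \<noteq> y"
        using ij(5) by auto
      ultimately show ?thesis
        unfolding witness_derived_order[OF that] using ij(1-4) by blast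
    qed
    then show "(x, y) \<in> strongest_derivable_order r E lt I"
      unfolding strongest_derivable_order_def by blast
  next
    fix x y assume xy: "(x, y) \<in> strongest_derivable_order r E lt I"
    then have derived: "(x, y) \<in> derived_order r I T" if "witness r E lt I T" for T
      using that unfolding strongest_derivable_order_def by blast
    obtain i j where ij: "i < length r" "j < length r" "(i, j) \<in> T\<^sub>0" "(r ! i) I = x" "(r ! j) I = y" "x \<noteq> y"
      using derived[OF T\<^sub>0] unfolding witness_derived_order[OF T\<^sub>0] by blast
    then have col: "x \<in> column_values r I" "y \<in> column_values r I"
      by (auto simp: column_values_def)
    have "\<gamma> x < \<gamma> y"
    proof (rule ccontr)
      assume "\<not> \<gamma> x < \<gamma> y"
      then consider "\<gamma> y < \<gamma> x" | "\<gamma> x = \<gamma> y" by linarith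
      then show False
      proof cases
        case 1
        then have "((r ! j) E, (r ! i) E) \<in> lt"
          using less[of "r ! j" "r ! i"] ij by simp
        then have "(j, i) \<in> T\<^sub>0"
          using T\<^sub>0 ij(1,2) unfolding witness_def by blast
        moreover have "trans T\<^sub>0" "irrefl T\<^sub>0"
          using T\<^sub>0 unfolding witness_def strict_linear_order_on_def by auto
        ultimately show False
          using ij(3) by (meson irrefl_def transD)
      next
        case 2
        \<comment> \<open>Values of one group can be reordered freely: move \<open>y\<close> to the front of its group.\<close>
        let ?q = "\<lambda>z. if z = y then 0 else Suc (q z)"
        have "inj_on ?q (column_values r I)"
          using q by (auto simp: inj_on_def)
        from witness[OF this] obtain T where T: "witness r E lt I T"
          "\<And>i j. \<gamma> ((r ! i) I) = \<gamma> ((r ! j) I) \<Longrightarrow> ?q ((r ! i) I) < ?q ((r ! j) I) \<Longrightarrow> (i, j) \<in> T"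
          by blast
        have "(j, i) \<in> T"
          by (rule T(2)) (use 2 ij in auto)
        then have "(y, x) \<in> derived_order r I T"
          unfolding witness_derived_order[OF T(1)] using ij by blast
        then show False
          using witness_derived_order_asym[OF T(1)] derived[OF T(1)] by blast
      qed
    qed
    with col show "(x, y) \<in> ?R" by blast
  qed
qed

section \<open>Criteria for the two possible answers\<close>

lemma distinct_concat_index:
  assumes "distinct (concat gs)"
  obtains \<gamma> where "\<And>i x. i < length gs \<Longrightarrow> x \<in> set (gs ! i) \<Longrightarrow> \<gamma> x = i"
proof
  have unique: "i = j" if "i < length gs" "j < length gs" "x \<in> set (gs ! i)" "x \<in> set (gs ! j)" for i j x
    using that assms
  proof (induction gs arbitrary: i j)
    case (Cons g gs)
    then have "x \<notin> set (gs ! k)" if "x \<in> set g" "k < length gs" for k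
      using that nth_mem by fastforce
    with Cons show ?case by (cases i; cases j) auto
  qed simp
  show "(THE i. i < length gs \<and> x \<in> set (gs ! i)) = i" if "i < length gs" "x \<in> set (gs ! i)" for i x
    using that unique by blast
qed

lemma ei_discovery_result_Some:
  assumes lt: "strict_linear_order_on (column_values r E) lt"
    and gs: "distinct (concat gs)" "[] \<notin> set gs" "set (concat gs) = column_values r I"
    and less: "\<And>i j s t. s \<in> set r \<Longrightarrow> t \<in> set r \<Longrightarrow> i < j \<Longrightarrow> j < length gs \<Longrightarrow>
      s I \<in> set (gs ! i) \<Longrightarrow> t I \<in> set (gs ! j) \<Longrightarrow> (s E, t E) \<in> lt"
    and eq: "\<And>i s t. s \<in> set r \<Longrightarrow> t \<in> set r \<Longrightarrow> i < length gs \<Longrightarrow>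
      s I \<in> set (gs ! i) \<Longrightarrow> t I \<in> set (gs ! i) \<Longrightarrow> s I = t I \<or> s E = t E"
  shows "ei_discovery_result r E lt I (Some gs)"
proof -
  obtain \<gamma> where \<gamma>: "\<And>i x. i < length gs \<Longrightarrow> x \<in> set (gs ! i) \<Longrightarrow> \<gamma> x = i"
    using distinct_concat_index[OF gs(1)] by metis
  have mem: "\<exists>i<length gs. x \<in> set (gs ! i)" if "x \<in> column_values r I" for x
    using that unfolding gs(3)[symmetric] by (auto simp: in_set_conv_nth) (metis in_set_conv_nth)
  have \<gamma>': "\<gamma> x < length gs" "x \<in> set (gs ! \<gamma> x)" if "x \<in> column_values r I" for x
    using mem[OF that] \<gamma> by auto
  have col: "s I \<in> column_values r I" if "s \<in> set r" for s
    using that by (simp add: column_values_def)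
  have "(s E, t E) \<in> lt" if "s \<in> set r" "t \<in> set r" "\<gamma> (s I) < \<gamma> (t I)" for s t
    using less[OF that] \<gamma>' col that by blast
  moreover have "s I = t I \<or> s E = t E" if "s \<in> set r" "t \<in> set r" "\<gamma> (s I) = \<gamma> (t I)" for s t
    using eq[OF that(1,2), of "\<gamma> (s I)"] \<gamma>' col that by metis
  ultimately have valid: "ei_oc_valid r E lt I" and strongest: "strongest_derivable_order r E lt I =
      {(x, y). x \<in> column_values r I \<and> y \<in> column_values r I \<and> \<gamma> x < \<gamma> y}"
    using strongest_derivable_order_eq[OF lt] by blast+
  have "{(x, y). x \<in> column_values r I \<and> y \<in> column_values r I \<and> \<gamma> x < \<gamma> y} =
      {(x, y). \<exists>i j. i < j \<and> j < length gs \<and> x \<in> set (gs ! i) \<and> y \<in> set (gs ! j)}"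
  proof (intro subset_antisym subrelI)
    fix x y assume "(x, y) \<in> {(x, y). \<exists>i j. i < j \<and> j < length gs \<and> x \<in> set (gs ! i) \<and> y \<in> set (gs ! j)}"
    then obtain i j where ij: "i < j" "j < length gs" "x \<in> set (gs ! i)" "y \<in> set (gs ! j)" by blast
    then have "\<gamma> x = i" "\<gamma> y = j" using \<gamma> by auto
    moreover have "gs ! i \<in> set gs" "gs ! j \<in> set gs"
      using ij by auto
    then have "x \<in> column_values r I" "y \<in> column_values r I"
      unfolding gs(3)[symmetric] using ij by auto
    ultimately show "(x, y) \<in> {(x, y). x \<in> column_values r I \<and> y \<in> column_values r I \<and> \<gamma> x < \<gamma> y}"
      using ij by blast
  qed (use \<gamma>' in blast)
  with valid strongest gs show ?thesis
    unfolding ei_discovery_result_def sorted_groups_def by simp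
qed

text \<open>Any witness places \<open>t\<close> between \<open>s\<close> and \<open>u\<close>, so
  the \<open>I\<close>-value shared by these two would come both before and after that of
  \<open>t\<close>.\<close>

lemma not_ei_oc_valid:
  assumes "s \<in> set r" "t \<in> set r" "u \<in> set r" "s I = u I" "t I \<noteq> s I" "(s E, t E) \<in> lt" "(t E, u E) \<in> lt"
  shows "\<not> ei_oc_valid r E lt I"
proof
  assume "ei_oc_valid r E lt I"
  then obtain T where T: "witness r E lt I T"
    unfolding ei_oc_valid_def by blast
  obtain i j k where "i < length r" "j < length r" "k < length r" "r ! i = s" "r ! j = t" "r ! k = u"
    using assms(1-3) by (metis in_set_conv_nth)
  moreover from this have "(i, j) \<in> T" "(j, k) \<in> T"
    using T assms(6,7) unfolding witness_def by blast+
  ultimately have "(s I, t I) \<in> derived_order r I T" "(t I, s I) \<in> derived_order r I T"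
    unfolding witness_derived_order[OF T] using assms(4,5) by metis+
  then show False
    using witness_derived_order_asym[OF T] by blast
qed

subsection \<open>The program\<close>

definition emit_result :: cmd where
  "emit_result =
     Seq (Assign 3 (EHd (EVar 6))) (Seq (Assign 11 ENil) (Seq (Assign 12 ENil) (Seq (Assign 13 ENil)
     (Seq emit_groups (If (EVar 12) (Assign 0 ENil) (Assign 0 (ECons ENil (EVar 13))))))))"

definition discover :: cmd where
  "discover =
     Seq (Assign 1 (EHd (EVar 0))) (Seq (Assign 2 (ETl (EVar 0)))
     (Seq scan_table (Seq sort_runs emit_result)))"

section \<open>Ranks of values, and the total cost of the stages\<close>

lemma less_iff_card_less:
  assumes "finite V" "trans lt" "irrefl lt" "total_on V lt" "x \<in> V" "y \<in> V"
  shows "(x, y) \<in> lt \<longleftrightarrow> card {z \<in> V. (z, x) \<in> lt} < card {z \<in> V. (z, y) \<in> lt}"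
proof -
  have mono: "card {z \<in> V. (z, x) \<in> lt} < card {z \<in> V. (z, y) \<in> lt}" if "(x, y) \<in> lt" "x \<in> V" for x y
  proof (rule psubset_card_mono)
    show "{z \<in> V. (z, x) \<in> lt} \<subset> {z \<in> V. (z, y) \<in> lt}"
    proof
      show "{z \<in> V. (z, x) \<in> lt} \<subseteq> {z \<in> V. (z, y) \<in> lt}"
        using that(1) assms(2) by (auto dest: transD)
      show "{z \<in> V. (z, x) \<in> lt} \<noteq> {z \<in> V. (z, y) \<in> lt}"
        using that assms(3) unfolding irrefl_def by blast
    qed
  qed (use assms(1) in simp)
  show ?thesis
  proof (cases "(x, y) \<in> lt")
    case False
    then have "x = y \<or> (y, x) \<in> lt"
      using assms(4-6) unfolding total_on_def by blast
    with False mono[of y x] assms(6) show ?thesis by fastforce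
  qed (use mono assms(5) in blast)
qed

lemma least_tableD:
  assumes "least_table lt K G S m" "b \<in> G ` S"
  shows "\<exists>t\<in>S. G t = b \<and> m b = VAL (K t)"
  using assms unfolding least_table_def by blast

text \<open>The number of \<open>E\<close>-values below the minimum of a group serves as the natural
  rank on which \<open>sorted_merge\<close> relies.\<close>

lemma ex_key_rank:
  assumes "finite S" "trans lt" "irrefl lt" "total_on (K ` S) lt" "least_table lt K G S (h 0)"
  shows "\<exists>f :: 'v \<Rightarrow> nat. \<forall>x\<in>G ` S. \<forall>y\<in>G ` S. key_less lt h x y \<longleftrightarrow> f x < f y"
proof -
  have "\<forall>b\<in>G ` S. \<exists>k. k \<in> K ` S \<and> h 0 b = VAL k"
    using least_tableD[OF assms(5)] by blast
  then obtain key where key: "\<forall>b\<in>G ` S. key b \<in> K ` S \<and> h 0 b = VAL (key b)"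
    by metis
  then have "key_less lt h x y \<longleftrightarrow>
      card {z \<in> K ` S. (z, key x) \<in> lt} < card {z \<in> K ` S. (z, key y) \<in> lt}"
    if "x \<in> G ` S" "y \<in> G ` S" for x y
  proof -
    have "key x \<in> K ` S" "key y \<in> K ` S" "h 0 x = VAL (key x)" "h 0 y = VAL (key y)"
      using key that by blast+
    then show ?thesis
      using less_iff_card_less[OF _ assms(2-4), of "key x" "key y"] assms(1) by simp
  qed
  then show ?thesis
    by (intro exI[of _ "\<lambda>x. card {z \<in> K ` S. (z, key x) \<in> lt}"]) blast
qed

lemma wp_sort_scanned:
  fixes K G I :: "'t \<Rightarrow> 'v"
  assumes S: "finite S" "card (G ` S) \<le> 2 ^ p"
    and lt: "trans lt" "irrefl lt" "total_on (K ` S) lt"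
    and sc: "scanned lt K G I S (v 6) h"
  shows "wp lt sort_runs (v, h) (\<lambda>k s. k \<le> 75 * p * card (G ` S) + 3 \<and> snd s = h \<and>
      (\<exists>bs. hd_tree (fst s 6) = run_tree bs \<and> distinct bs \<and> set bs = G ` S \<and>
        sorted_wrt (\<lambda>x y. \<not> key_less lt h x y) bs))"
proof -
  obtain bs where bs: "v 6 = list_tree (map (\<lambda>b. run_tree [b]) bs)" "distinct bs" "set bs = G ` S"
    using sc unfolding scanned_def by blast
  let ?xss = "map (\<lambda>b. [b]) bs"
  have concat: "concat ?xss = bs"
    by (induction bs) auto
  have len: "length bs = card (G ` S)"
    using distinct_card[OF bs(2)] bs(3) by simp
  have "least_table lt K G S (h 0)"
    using sc unfolding scanned_def by blast
  from ex_key_rank[of S lt K G h, OF S(1) lt this]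
  obtain f :: "'v \<Rightarrow> nat" where f: "\<forall>x\<in>G ` S. \<forall>y\<in>G ` S. key_less lt h x y \<longleftrightarrow> f x < f y"
    by blast
  have "wp lt sort_runs (v, h) (\<lambda>k s. k \<le> p * (75 * length (concat ?xss)) + 3 \<and> snd s = h \<and>
      (\<exists>xs. hd_tree (fst s 6) = run_tree xs \<and> mset xs = mset (concat ?xss) \<and>
        sorted_wrt (\<lambda>x y. f y \<le> f x) xs))"
  proof (rule wp_sort_runs)
    show "v 6 = list_tree (map run_tree ?xss)"
      using bs(1) by (simp add: comp_def)
    show "length ?xss \<le> 2 ^ p"
      using S(2) len by simp
    show "key_less lt h x y \<longleftrightarrow> f x < f y" if "x \<in> set (concat ?xss)" "y \<in> set (concat ?xss)" for x y
      using f that unfolding concat bs(3) by blast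
  qed auto
  then show ?thesis
  proof (rule wp_mono, elim conjE exE)
    fix k s xs
    assume k: "k \<le> p * (75 * length (concat ?xss)) + 3" "snd s = h" "hd_tree (fst s 6) = run_tree xs"
      and xs: "mset xs = mset (concat ?xss)" "sorted_wrt (\<lambda>x y. f y \<le> f x) xs"
    have set: "set xs = G ` S"
      using xs(1) bs(3) unfolding concat by (metis set_mset_mset)
    moreover have "distinct xs"
      using xs(1) bs(2) unfolding concat by (metis mset_eq_imp_distinct_iff)
    moreover have "sorted_wrt (\<lambda>x y. \<not> key_less lt h x y) xs"
      by (rule sorted_wrt_mono_rel[OF _ xs(2)]) (use f set in force)
    moreover have "k \<le> 75 * p * card (G ` S) + 3"
      using k(1) unfolding concat len by (simp add: mult_ac)
    ultimately show "k \<le> 75 * p * card (G ` S) + 3 \<and> snd s = h \<and>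
      (\<exists>bs. hd_tree (fst s 6) = run_tree bs \<and> distinct bs \<and> set bs = G ` S \<and>
        sorted_wrt (\<lambda>x y. \<not> key_less lt h x y) bs)"
      using k(2,3) by blast
  qed
qed

lemma wp_emit_result:
  assumes "hd_tree (v 6) = run_tree bs"
  shows "wp lt emit_result (v, h) (\<lambda>k s. k \<le> 30 * length bs + 20 \<and>
    fst s 0 = (if successively (\<lambda>x y. less_val lt (h 4 y) (h 0 x)) bs
      then CONS NIL (list_tree (rev (map (h 3) bs))) else NIL))"
  unfolding emit_result_def
  apply (simp split del: if_split)
  apply (rule wp_mono, rule wp_emit_groups[where bs = bs and nxt = None and out = "[]"])
  using assms apply simp_all
  subgoal for k s by (cases s) auto
  done

lemma wp_discover:
  fixes ts :: "'t list" and K G I :: "'t \<Rightarrow> 'v"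
  assumes lt: "trans lt" "irrefl lt" "total_on (K ` set ts) lt"
    and fd: "\<And>s t. s \<in> set ts \<Longrightarrow> t \<in> set ts \<Longrightarrow> I s = I t \<Longrightarrow> G s = G t"
    and v: "v 0 = CONS c (list_tree (map (\<lambda>t. CONS (VAL (a t)) (VAL (G t))) ts))" "v 6 = NIL"
    and c: "\<And>t. if c = NIL then K t = G t \<and> I t = a t else K t = a t \<and> I t = G t"
    and p: "card (G ` set ts) \<le> 2 ^ p"
  shows "wp lt discover (v, \<lambda>_ _. NIL) (\<lambda>k s.
    k \<le> 62 * length ts + (75 * p + 30) * card (G ` set ts) + 40 \<and>
    (\<exists>h bs. least_table lt K G (set ts) (h 0) \<and> least_table (lt\<inverse>) K G (set ts) (h 4) \<and>
       bucket_table I G (set ts) (h 2) (h 3) \<and> distinct bs \<and> set bs = G ` set ts \<and>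
       sorted_wrt (\<lambda>x y. \<not> key_less lt h x y) bs \<and>
       fst s 0 = (if successively (\<lambda>x y. less_val lt (h 4 y) (h 0 x)) bs
         then CONS NIL (list_tree (rev (map (h 3) bs))) else NIL)))"
    (is "wp _ _ _ ?Q")
proof -
  let ?m = "card (G ` set ts)" and ?d = "list_tree (map (\<lambda>t. CONS (VAL (a t)) (VAL (G t))) ts)"
  have "scanned lt K G I {} NIL (\<lambda>_ _. NIL)"
    by (simp add: scanned_def least_table_def bucket_table_def)
  then have init: "scanned lt K G I {} ((v(1 := c, 2 := ?d)) 6) (\<lambda>_ _. NIL)"
    by (simp add: v)
  have scan: "wp lt scan_table (v(1 := c, 2 := ?d), \<lambda>_ _. NIL)
      (\<lambda>k s. k \<le> 62 * length ts + 2 \<and> scanned lt K G I ({} \<union> set ts) (fst s 6) (snd s))"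
  proof (rule wp_scan_table[where v = "v(1 := c, 2 := ?d)" and S = "{}" and a = a, OF lt(1,2) _ init])
    show "(v(1 := c, 2 := ?d)) 2 = ?d" by simp
    show "G s = G t" if "s \<in> {} \<union> set ts" "t \<in> {} \<union> set ts" "I s = I t" for s t
      using fd[of s t] that by simp
    show "if (v(1 := c, 2 := ?d)) 1 = NIL then K t = G t \<and> I t = a t else K t = a t \<and> I t = G t" for t
      using c[of t] by simp
  qed
  have rest: "wp lt sort_runs s (\<lambda>k s. wp lt emit_result s (\<lambda>l s. ?Q (6 + (i + (k + l))) s))"
    if i: "i \<le> 62 * length ts + 2" and sc: "scanned lt K G I (set ts) (fst s 6) (snd s)" for i s
  proof -
    have "wp lt sort_runs (fst s, snd s) (\<lambda>k s. wp lt emit_result s (\<lambda>l s. ?Q (6 + (i + (k + l))) s))"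
    proof (rule wp_mono[OF wp_sort_scanned[where v = "fst s", OF _ p lt sc]], simp, elim conjE exE)
      fix k and s' :: "'v state" and bs
      assume k: "k \<le> 75 * p * ?m + 3" "snd s' = snd s"
        and bs: "hd_tree (fst s' 6) = run_tree bs" "distinct bs" "set bs = G ` set ts"
          "sorted_wrt (\<lambda>x y. \<not> key_less lt (snd s) x y) bs"
      have len: "length bs = ?m"
        using distinct_card[OF bs(2)] bs(3) by simp
      have "wp lt emit_result (fst s', snd s) (\<lambda>l s. ?Q (6 + (i + (k + l))) s)"
      proof (rule wp_mono[OF wp_emit_result[where v = "fst s'", OF bs(1)]], elim conjE)
        fix l and s'' :: "'v state"
        assume l: "l \<le> 30 * length bs + 20" and out: "fst s'' 0 =
          (if successively (\<lambda>x y. less_val lt (snd s 4 y) (snd s 0 x)) bs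
           then CONS NIL (list_tree (rev (map (snd s 3) bs))) else NIL)"
        \<comment> \<open>The 6 pays for the two assignments before the scan. With 2, 3 and 20 from
          the stages the fixed costs are 31, rounded up to 40.\<close>
        have "6 + (i + (k + l)) \<le> 62 * length ts + (75 * p + 30) * ?m + 40"
          using i k(1) l unfolding len by (simp add: algebra_simps)
        with sc bs out show "?Q (6 + (i + (k + l))) s''"
          unfolding scanned_def by blast
      qed
      then show "wp lt emit_result s' (\<lambda>l s. ?Q (6 + (i + (k + l))) s)"
        using k(2) by (metis prod.collapse)
    qed
    then show ?thesis by simp
  qed
  show ?thesis
    unfolding discover_def wp_Seq wp_Assign
    apply (rule wp_mono[where Q = "\<lambda>k s. k \<le> 62 * length ts + 2 \<and> scanned lt K G I ({} \<union> set ts) (fst s 6) (snd s)"])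
    subgoal using scan v by (simp add: One_nat_def[symmetric] del: One_nat_def)
    subgoal for k s by (rule wp_mono[OF rest[of k s]]) (auto elim: wp_mono)
    done
qed

subsection \<open>Correctness of the result\<close>

lemma not_successivelyE:
  assumes "\<not> successively P xs"
  obtains us x y vs where "xs = us @ x # y # vs" "\<not> P x y"
proof -
  have "\<exists>us x y vs. xs = us @ x # y # vs \<and> \<not> P x y"
    using assms
  proof (induction xs rule: induct_list012)
    case (3 x y zs)
    show ?case
    proof (cases "P x y")
      case True
      with 3 obtain us a b vs where "y # zs = us @ a # b # vs" "\<not> P a b" by auto
      then show ?thesis by (intro exI[of _ "x # us"]) auto
    qed (intro exI[of _ "[]"], auto)
  qed auto
  then show ?thesis using that by blast
qed

lemma distinct_concat_map:
  "distinct xs \<Longrightarrow> (\<And>x. x \<in> set xs \<Longrightarrow> distinct (f x)) \<Longrightarrow>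
    (\<And>x y. x \<in> set xs \<Longrightarrow> y \<in> set xs \<Longrightarrow> x \<noteq> y \<Longrightarrow> set (f x) \<inter> set (f y) = {}) \<Longrightarrow>
    distinct (concat (map f xs))"
proof (induction xs)
  case (Cons x xs)
  have "distinct (concat (map f xs))"
    by (rule Cons.IH) (use Cons.prems in auto)
  moreover have "set (f x) \<inter> set (f y) = {}" if "y \<in> set xs" for y
    using Cons.prems(3)[of x y] Cons.prems(1) that by auto
  ultimately show ?case
    using Cons.prems(2)[of x] by auto
qed simp

text \<open>The memory after sorting, read as functions and a list, which separates correctness from
  the machine. \<open>bs\<close> descends with respect to \<open>mn\<close>.\<close>

locale grouped_table =
  fixes r :: "('c, 'v) table" and A B E I :: 'c and lt :: "'v rel"
    and mn mx :: "'v \<Rightarrow> 'v" and bucket :: "'v \<Rightarrow> 'v list" and bs :: "'v list"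
  assumes attributes: "A \<noteq> B" "{E, I} = {A, B}" and fd: "fd_holds r A B"
    and order: "strict_linear_order_on (column_values r E) lt"
    and bs: "distinct bs" "set bs = column_values r B" "sorted_wrt (\<lambda>x y. (mn x, mn y) \<notin> lt) bs"
    and mn: "\<And>b. b \<in> set bs \<Longrightarrow> \<exists>t\<in>set r. t B = b \<and> t E = mn b"
      "\<And>t. t \<in> set r \<Longrightarrow> (t E, mn (t B)) \<notin> lt"
    and mx: "\<And>b. b \<in> set bs \<Longrightarrow> \<exists>t\<in>set r. t B = b \<and> t E = mx b"
      "\<And>t. t \<in> set r \<Longrightarrow> (mx (t B), t E) \<notin> lt"
    and bucket: "\<And>b. distinct (bucket b)" "\<And>b. set (bucket b) = {t I | t. t \<in> set r \<and> t B = b}"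
begin

abbreviation separated :: "'v \<Rightarrow> 'v \<Rightarrow> bool" where
  "separated x y \<equiv> (mx y, mn x) \<in> lt"

lemma trans_lt: "(x, y) \<in> lt \<Longrightarrow> (y, z) \<in> lt \<Longrightarrow> (x, z) \<in> lt"
  and irrefl_lt: "(x, x) \<notin> lt"
  and total_lt: "s \<in> set r \<Longrightarrow> t \<in> set r \<Longrightarrow> s E \<noteq> t E \<Longrightarrow> (s E, t E) \<in> lt \<or> (t E, s E) \<in> lt"
  using order unfolding strict_linear_order_on_def trans_def irrefl_def total_on_def column_values_def
  by blast+

lemma cases_EI: obtains "E = A" "I = B" | "E = B" "I = A"
  using attributes by (metis doubleton_eq_iff)

lemma I_determines_B: "s \<in> set r \<Longrightarrow> t \<in> set r \<Longrightarrow> s I = t I \<Longrightarrow> s B = t B"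
  using fd by (cases rule: cases_EI) (auto simp: fd_holds_def)

lemma B_in_bs: "t \<in> set r \<Longrightarrow> t B \<in> set bs"
  by (simp add: bs column_values_def)

lemma mem_bucket: "t \<in> set r \<Longrightarrow> t I \<in> set (bucket b) \<longleftrightarrow> t B = b"
  using I_determines_B unfolding bucket by blast

text \<open>The \<open>E\<close>-value of \<open>s\<close> is at most the maximum of its group,
  which is below the minimum of the group of \<open>t\<close>, which is at most the
  \<open>E\<close>-value of \<open>t\<close>.\<close>

lemma separated_less:
  assumes "s \<in> set r" "t \<in> set r" "separated (t B) (s B)"
  shows "(s E, t E) \<in> lt"
proof -
  obtain s' where s': "s' \<in> set r" "s' E = mx (s B)"
    using mx(1)[OF B_in_bs] assms(1) by metis
  obtain t' where t': "t' \<in> set r" "t' E = mn (t B)"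
    using mn(1)[OF B_in_bs] assms(2) by metis
  have "s E = mx (s B) \<or> (s E, mx (s B)) \<in> lt"
    using total_lt[OF assms(1) s'(1)] mx(2)[OF assms(1)] s'(2) by auto
  moreover have "t E = mn (t B) \<or> (mn (t B), t E) \<in> lt"
    using total_lt[OF assms(2) t'(1)] mn(2)[OF assms(2)] t'(2) by auto
  ultimately show ?thesis
    using assms(3) trans_lt by metis
qed

text \<open>This is why checking neighbours is enough. Applied to tuples attaining the maxima of
  \<open>z\<close> and \<open>y\<close>, \<open>separated_less\<close> gives
  \<open>(mx z, mx y) \<in> lt\<close>.\<close>

lemma separated_trans:
  assumes "x \<in> set bs" "y \<in> set bs" "z \<in> set bs" "separated x y" "separated y z"
  shows "separated x z"
proof -
  obtain s t where "s \<in> set r" "s B = z" "s E = mx z" "t \<in> set r" "t B = y" "t E = mx y"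
    using mx(1) assms(2,3) by metis
  then have "(mx z, mx y) \<in> lt"
    using separated_less[of s t] assms(5) by simp
  then show ?thesis
    using assms(4) by (rule trans_lt)
qed

lemma discovery_result_valid:
  assumes "successively separated bs"
  shows "ei_discovery_result r E lt I (Some (rev (map bucket bs)))"
proof (rule ei_discovery_result_Some[OF order])
  let ?gs = "rev (map bucket bs)"
  have nth: "?gs ! i = bucket (rev bs ! i)" if "i < length bs" for i
    using that by (simp add: rev_map)
  have "sorted_wrt separated bs"
    using assms separated_trans successively_iff_sorted_wrt_strong[of bs separated] by blast
  then have sep: "separated (rev bs ! j) (rev bs ! i)" if "i < j" "j < length bs" for i j
    using that sorted_wrt_nth_less[of "\<lambda>x y. separated y x" "rev bs" i j] by (simp add: sorted_wrt_rev)
  show "distinct (concat ?gs)"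
    unfolding distinct_concat_rev
  proof (rule distinct_concat_map[OF bs(1) bucket(1)])
    show "set (bucket x) \<inter> set (bucket y) = {}" if "x \<noteq> y" for x y
      using that by (auto simp: bucket(2) dest: I_determines_B)
  qed
  have "bucket b \<noteq> []" if b: "b \<in> set bs" for b
  proof -
    obtain t where "t \<in> set r" "t B = b"
      using mn(1)[OF b] by blast
    then show ?thesis
      using mem_bucket[of t b] by auto
  qed
  then show "[] \<notin> set ?gs"
    by fastforce
  show "set (concat ?gs) = column_values r I"
    using B_in_bs by (auto simp: bucket column_values_def)
  show "(s E, t E) \<in> lt" if "s \<in> set r" "t \<in> set r" "i < j" "j < length ?gs"
    "s I \<in> set (?gs ! i)" "t I \<in> set (?gs ! j)" for i j s t
    using that sep[of i j] separated_less[of s t] nth[of i] nth[of j] by (simp add: mem_bucket)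
  show "s I = t I \<or> s E = t E" if "s \<in> set r" "t \<in> set r" "i < length ?gs"
    "s I \<in> set (?gs ! i)" "t I \<in> set (?gs ! i)" for i s t
  proof -
    have "s B = t B"
      using that nth[of i] by (simp add: mem_bucket)
    \<comment> \<open>Agreement on \<open>B\<close> is agreement on \<open>I\<close> in the first
      case and on \<open>E\<close> in the second.\<close>
    then show ?thesis
      by (cases rule: cases_EI) auto
  qed
qed

text \<open>At neighbours \<open>x\<close>, \<open>y\<close> that fail the check, tuples attaining
  \<open>mn y\<close>, \<open>mn x\<close> and \<open>mx y\<close>, in this order, form the pattern
  of \<open>not_ei_oc_valid\<close>.\<close>

lemma discovery_result_invalid:
  assumes "\<not> successively separated bs"
  shows "ei_discovery_result r E lt I None"
proof -
  obtain us x y vs where split: "bs = us @ x # y # vs" and sep: "(mx y, mn x) \<notin> lt"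
    using assms by (rule not_successivelyE)
  have xy: "x \<in> set bs" "y \<in> set bs" "x \<noteq> y" "(mn x, mn y) \<notin> lt"
    using bs(1,3) unfolding split by (auto simp: sorted_wrt_append)
  obtain s where s: "s \<in> set r" "s B = y" "s E = mn y" using mn(1)[OF xy(2)] by blast
  obtain t where t: "t \<in> set r" "t B = x" "t E = mn x" using mn(1)[OF xy(1)] by blast
  obtain u where u: "u \<in> set r" "u B = y" "u E = mx y" using mx(1)[OF xy(2)] by blast
  have "\<not> ei_oc_valid r E lt I"
  proof (cases rule: cases_EI)
    case 1
    have "s E \<noteq> t E" "t E \<noteq> u E"
      \<comment> \<open>As \<open>E = A\<close> determines \<open>B\<close>, tuples of different
        groups differ on \<open>E\<close>; this makes the comparisons strict.\<close>
      using fd s(1,2) t(1,2) u(1,2) xy(3) unfolding fd_holds_def 1 by metis+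
    then have "(s E, t E) \<in> lt" "(t E, u E) \<in> lt"
      using total_lt[OF s(1) t(1)] total_lt[OF t(1) u(1)] xy(4) sep s(3) t(3) u(3) by auto
    then show ?thesis
      using not_ei_oc_valid[OF s(1) t(1) u(1)] s(2) t(2) u(2) xy(3) 1 by metis
  next
    case 2
    \<comment> \<open>With \<open>E = B\<close> a group has a single \<open>E\<close>-value, so
      \<open>mn\<close> and \<open>mx\<close> coincide on it and the failed check contradicts the
      sorting: this case cannot occur.\<close>
    then show ?thesis
      using total_lt[OF s(1) t(1)] s t u xy sep by auto
  qed
  then show ?thesis
    by (simp add: ei_discovery_result_def)
qed

end

lemma ex_discovery_result:
  fixes r :: "('c, 'v) table"
  assumes "A \<noteq> B" "{E, I} = {A, B}" "fd_holds r A B" "strict_linear_order_on (column_values r E) lt"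
    and least: "least_table lt (\<lambda>t. t E) (\<lambda>t. t B) (set r) (h 0)"
      "least_table (lt\<inverse>) (\<lambda>t. t E) (\<lambda>t. t B) (set r) (h 4)"
    and bucket: "bucket_table (\<lambda>t. t I) (\<lambda>t. t B) (set r) (h 2) (h 3)"
    and bs: "distinct bs" "set bs = (\<lambda>t. t B) ` set r" "sorted_wrt (\<lambda>x y. \<not> key_less lt h x y) bs"
  shows "\<exists>res. ei_discovery_result r E lt I res \<and>
    output_tree res = (if successively (\<lambda>x y. less_val lt (h 4 y) (h 0 x)) bs
      then CONS NIL (list_tree (rev (map (h 3) bs))) else NIL)"
proof -
  have "\<forall>b\<in>set bs. \<exists>k. h 0 b = VAL k \<and> (\<exists>t\<in>set r. t B = b \<and> t E = k) \<and>
      (\<forall>t\<in>set r. t B = b \<longrightarrow> (t E, k) \<notin> lt)"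
    using least(1) unfolding least_table_def bs(2) by fast
  then obtain mn where mn_eq: "\<forall>b\<in>set bs. h 0 b = VAL (mn b) \<and> (\<exists>t\<in>set r. t B = b \<and> t E = mn b) \<and>
      (\<forall>t\<in>set r. t B = b \<longrightarrow> (t E, mn b) \<notin> lt)"
    unfolding bchoice_iff by blast
  have "\<forall>b\<in>set bs. \<exists>k. h 4 b = VAL k \<and> (\<exists>t\<in>set r. t B = b \<and> t E = k) \<and>
      (\<forall>t\<in>set r. t B = b \<longrightarrow> (k, t E) \<notin> lt)"
    using least(2) unfolding least_table_def bs(2) converse_iff by fast
  then obtain mx where mx_eq: "\<forall>b\<in>set bs. h 4 b = VAL (mx b) \<and> (\<exists>t\<in>set r. t B = b \<and> t E = mx b) \<and>
      (\<forall>t\<in>set r. t B = b \<longrightarrow> (mx b, t E) \<notin> lt)"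
    unfolding bchoice_iff by blast
  have "\<forall>b. \<exists>xs. h 3 b = run_tree xs \<and> distinct xs \<and> set xs = (\<lambda>t. t I) ` {t \<in> set r. t B = b}"
    using bucket unfolding bucket_table_def by blast
  then obtain bk where bk: "\<forall>b. h 3 b = run_tree (bk b) \<and> distinct (bk b) \<and>
      set (bk b) = (\<lambda>t. t I) ` {t \<in> set r. t B = b}"
    unfolding choice_iff by blast
  have mem: "t B \<in> set bs" if "t \<in> set r" for t
    using that bs(2) by simp
  interpret grouped_table r A B E I lt mn mx bk bs
  proof
    show "sorted_wrt (\<lambda>x y. (mn x, mn y) \<notin> lt) bs"
      by (rule sorted_wrt_mono_rel[OF _ bs(3)]) (use mn_eq in simp)
    show "set (bk b) = {t I | t. t \<in> set r \<and> t B = b}" for b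
      using bk by auto
  qed (use assms(1-4) bs(1,2) mn_eq mx_eq bk mem in \<open>auto simp: column_values_def\<close>)
  have check: "successively (\<lambda>x y. less_val lt (h 4 y) (h 0 x)) bs \<longleftrightarrow> successively separated bs"
    by (rule successively_cong) (use mn_eq mx_eq in simp_all)
  show ?thesis
  proof (cases "successively separated bs")
    case True
    have "output_tree (Some (rev (map bk bs))) = CONS NIL (list_tree (rev (map (h 3) bs)))"
    proof -
      have "h 3 = (\<lambda>b. run_tree (bk b))"
        using bk by auto
      then show ?thesis by (simp add: rev_map comp_def)
    qed
    with True check discovery_result_valid show ?thesis by metis
  next
    case False
    with check discovery_result_invalid show ?thesis by (intro exI[of _ None]) simp
  qed
qed

subsection \<open>The time bound\<close>

lemma ex_power_of_2_between:
  "\<exists>p. m \<le> 2 ^ p \<and> (1 \<le> m \<longrightarrow> 2 ^ p \<le> 2 * m)" for m :: nat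
proof -
  define p where "p = (LEAST p. m \<le> 2 ^ p)"
  have "m \<le> 2 ^ m" by (simp add: less_imp_le)
  then have "m \<le> 2 ^ p"
    unfolding p_def by (rule LeastI)
  moreover have "2 ^ p \<le> 2 * m" if "1 \<le> m"
  proof (cases p)
    case (Suc q)
    then have "\<not> m \<le> 2 ^ q"
      using not_less_Least[of q "\<lambda>p. m \<le> 2 ^ p"] unfolding p_def by simp
    with Suc show ?thesis by simp
  qed (use that in simp)
  ultimately show ?thesis by blast
qed

text \<open>The factor 2 in \<open>2 * m\<close> costs the summand 1, and the coefficient 2 bounds 1
  / ln 2.\<close>

lemma power_of_2_le_ln:
  assumes "1 \<le> m" "2 ^ p \<le> 2 * m"
  shows "real p \<le> 1 + 2 * ln (real m)"
proof -
  \<comment> \<open>\<open>ln x \<le> x - 1\<close> at \<open>x = 1 / 2\<close> reads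
    \<open>- ln 2 \<le> - 1 / 2\<close>.\<close>
  have half: "1 / 2 \<le> ln (2 :: real)"
    using ln_le_minus_one[of "1 / 2 :: real"] by (simp add: ln_div)
  have "real p * ln 2 = ln (real (2 ^ p))"
    by (simp add: ln_realpow)
  also have "\<dots> \<le> ln (real (2 * m))"
    using assms by (subst ln_le_cancel_iff) (auto simp del: of_nat_power of_nat_mult)
  also have "\<dots> = ln 2 + ln (real m)"
    using assms(1) by (simp add: ln_mult)
  finally have "(real p - 1) * ln 2 \<le> ln (real m)"
    by (simp add: algebra_simps)
  moreover have "real p \<le> 1" if "p = 0 \<or> p = 1" using that by auto
  moreover have "(real p - 1) * (1 / 2) \<le> (real p - 1) * ln 2" if "1 \<le> p"
    using half that by (intro mult_left_mono) auto
  moreover have "0 \<le> ln (real m)" using assms(1) by simp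
  ultimately show ?thesis
    by (cases "p = 0") auto
qed

lemma cost_bound:
  assumes "1 \<le> n" "1 \<le> m" "m \<le> n" "2 ^ p \<le> 2 * m" "k \<le> 62 * n + (75 * p + 30) * m + 40"
  shows "real k \<le> 250 * (real m * ln (real m) + real n)"
proof -
  have "real k \<le> real (62 * n + (75 * p + 30) * m + 40)"
    using assms(5) by (simp only: of_nat_le_iff)
  also have "\<dots> = 62 * real n + 75 * (real p * real m) + 30 * real m + 40"
    by (simp add: algebra_simps)
  also have "real p * real m \<le> (1 + 2 * ln (real m)) * real m"
    using power_of_2_le_ln[OF assms(2,4)] by (intro mult_right_mono) auto
  also have "62 * real n + 75 * ((1 + 2 * ln (real m)) * real m) + 30 * real m + 40 =
      62 * real n + 105 * real m + 40 + 150 * (real m * ln (real m))"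
    by (simp add: algebra_simps)
  \<comment> \<open>From \<open>m \<le> n\<close> and \<open>1 \<le> n\<close> the linear terms are
    at most (62 + 105 + 40) n = 207 n, and 150 is below 250 as well.\<close>
  also have "\<dots> \<le> 250 * (real m * ln (real m) + real n)"
  proof -
    have "0 \<le> real m * ln (real m)" using assms(2) by simp
    moreover have "real m \<le> real n" "1 \<le> real n" using assms(1,3) by auto
    ultimately show ?thesis unfolding distrib_left by linarith
  qed
  finally show ?thesis by simp
qed

theorem lemma1:
  shows "\<exists>(P :: cmd) (c :: real).
    \<forall>(r :: ('c, 'v) table) A B E I (lt :: 'v rel).
      A \<noteq> B \<and> fd_holds r A B \<and> {E, I} = {A, B} \<and>
      strict_linear_order_on (column_values r E) lt \<longrightarrow>
      (\<exists>k res.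
         computes_in P lt (input_tree r A B E) k (output_tree res) \<and>
         ei_discovery_result r E lt I res \<and>
         (let n = length r; m = card (column_values r B)
          in n \<ge> 1 \<longrightarrow> real k \<le> c * (real m * ln (real m) + real n)))"
proof (rule exI[of _ discover], rule exI[of _ 250], intro allI impI)
  fix r :: "('c, 'v) table" and A B E I and lt :: "'v rel"
  assume asm: "A \<noteq> B \<and> fd_holds r A B \<and> {E, I} = {A, B} \<and>
      strict_linear_order_on (column_values r E) lt"
  let ?m = "card (column_values r B)"
  have lt: "trans lt" "irrefl lt" "total_on ((\<lambda>t. t E) ` set r) lt"
    using asm by (auto simp: strict_linear_order_on_def column_values_def)
  have EI: "E = A \<and> I = B \<or> E = B \<and> I = A"
    using asm by (metis doubleton_eq_iff)
  obtain p where p: "?m \<le> 2 ^ p" "1 \<le> ?m \<longrightarrow> 2 ^ p \<le> 2 * ?m"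
    using ex_power_of_2_between by blast
  let ?v = "(\<lambda>_. NIL)(0 := input_tree r A B E)"
  have "wp lt discover (?v, \<lambda>_ _. NIL) (\<lambda>k s.
    k \<le> 62 * length r + (75 * p + 30) * card ((\<lambda>t. t B) ` set r) + 40 \<and>
    (\<exists>h bs. least_table lt (\<lambda>t. t E) (\<lambda>t. t B) (set r) (h 0) \<and>
       least_table (lt\<inverse>) (\<lambda>t. t E) (\<lambda>t. t B) (set r) (h 4) \<and>
       bucket_table (\<lambda>t. t I) (\<lambda>t. t B) (set r) (h 2) (h 3) \<and>
       distinct bs \<and> set bs = (\<lambda>t. t B) ` set r \<and>
       sorted_wrt (\<lambda>x y. \<not> key_less lt h x y) bs \<and>
       fst s 0 = (if successively (\<lambda>x y. less_val lt (h 4 y) (h 0 x)) bs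
         then CONS NIL (list_tree (rev (map (h 3) bs))) else NIL)))"
  proof (rule wp_discover[OF lt])
    show "s B = t B" if "s \<in> set r" "t \<in> set r" "s I = t I" for s t
      using asm EI that unfolding fd_holds_def by metis
    show "?v 0 = CONS (bool_tree (E = A)) (list_tree (map (\<lambda>t. CONS (VAL (t A)) (VAL (t B))) r))"
      by (simp add: input_tree_def)
    show "if bool_tree (E = A) = (NIL :: 'v tree) then t E = t B \<and> t I = t A else t E = t A \<and> t I = t B" for t
      using EI asm by auto
    show "card ((\<lambda>t. t B) ` set r) \<le> 2 ^ p"
      using p(1) by (simp add: column_values_def)
  qed simp
  then obtain k s h bs where exec: "exec lt discover (?v, \<lambda>_ _. NIL) k s"
    and k: "k \<le> 62 * length r + (75 * p + 30) * ?m + 40"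
    and result: "least_table lt (\<lambda>t. t E) (\<lambda>t. t B) (set r) (h 0)"
       "least_table (lt\<inverse>) (\<lambda>t. t E) (\<lambda>t. t B) (set r) (h 4)"
       "bucket_table (\<lambda>t. t I) (\<lambda>t. t B) (set r) (h 2) (h 3)"
       "distinct bs" "set bs = (\<lambda>t. t B) ` set r"
       "sorted_wrt (\<lambda>x y. \<not> key_less lt h x y) bs"
    and out: "fst s 0 = (if successively (\<lambda>x y. less_val lt (h 4 y) (h 0 x)) bs
         then CONS NIL (list_tree (rev (map (h 3) bs))) else NIL)"
    unfolding wp_def column_values_def by blast
  obtain res where res: "ei_discovery_result r E lt I res" "output_tree res = fst s 0"
    using ex_discovery_result[of A B E I r lt h bs] asm result unfolding out by blast
  have "computes_in discover lt (input_tree r A B E) k (output_tree res)"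
    unfolding computes_in_def using exec res(2) by metis
  moreover have "real k \<le> 250 * (real ?m * ln (real ?m) + real (length r))" if "length r \<ge> 1"
  proof (rule cost_bound[OF that _ _ _ k])
    \<comment> \<open>A nonempty table has at least one \<open>B\<close>-value, so the upper bound
      on \<open>2 ^ p\<close> is available.\<close>
    have "column_values r B \<noteq> {}" "finite (column_values r B)"
      using that by (auto simp: column_values_def)
    then show m: "1 \<le> ?m"
      by (simp add: Suc_le_eq card_gt_0_iff)
    show "?m \<le> length r"
      unfolding column_values_def using card_image_le[of "set r"] card_length[of r] by (meson List.finite_set order.trans)
    show "2 ^ p \<le> 2 * ?m"
      using p(2) m by blast
  qed
  ultimately show "\<exists>k res.
         computes_in discover lt (input_tree r A B E) k (output_tree res) \<and>
         ei_discovery_result r E lt I res \<and>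
         (let n = length r; m = card (column_values r B)
          in n \<ge> 1 \<longrightarrow> real k \<le> 250 * (real m * ln (real m) + real n))"
    using res(1) unfolding Let_def by blast
qed

end
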